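(* The augmented concept lattice functor $\mathcal B^{o}$ induces an equivalence between the category $\mathbf{Cjm}^{o}$ of purified contexts with separately continuous morphisms and the category $\mathbf{CLjm}^{o}$ of doubly based lattices with join-meet preserving pairs that induce mappings between the respective bases. In the opposite direction, an equivalence is established by the functor $\mathcal C^{o}$. Similarly, the category $\mathbf{C}^{o}$ of purified contexts with conceptual morphisms is equivalent to the category $\mathbf{CL}^{o}$ of doubly based lattices with complete homomorphisms preserving the join- and meet-bases.
   Context: **Contexts.** A (formal) context is a triple $\mathbb K=(J,M,I)$ with sets $J,M$ and $I\subseteq J\times M$. For $A\subseteq J$, $A^{\uparrow}=\{m\in M: j\,I\,m\ \forall j\in A\}$; for $B\subseteq M$, $B^{\downarrow}=\{j\in J: j\,I\,m\ \forall m\in B\}$; $j^{\uparrow}=\{j\}^{\uparrow}$, $m^{\downarrow}=\{m\}^{\downarrow}$. Extents are the sets $A$ with $A=A^{\uparrow\downarrow}$, intents the sets $B$ with $B=B^{\downarrow\uparrow}$. A concept is a pair $(A,B)$ with $A=B^{\downarrow}$, $B=A^{\uparrow}$. Ordered by $(A,B)\le(C,D)\iff A\subseteq C$, the concepts form a complete lattice $\mathcal B(\mathbb K)$. Put $\gamma_{\mathbb K}(j)=(j^{\uparrow\downarrow},j^{\uparrow})$, $\mu_{\mathbb K}(m)=(m^{\downarrow},m^{\downarrow\uparrow})$. $\mathbb K$ is purified if $\gamma_{\mathbb K}$ and $\mu_{\mathbb K}$ are injective. **Mapping pairs.** A mapping pair $(\alpha,\beta):\mathbb K=(J,M,I)\to\mathbb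 L=(H,N,R)$ consists of maps $\alpha:J\to H$, $\beta:M\to N$ (componentwise composition). It is separately continuous if $\alpha$-preimages of extents are extents and $\beta$-preimages of intents are intents; conceptual if it is separately continuous and $(A,B)\in\mathcal B(\mathbb K)$ implies $(\beta[B]^{\downarrow},\alpha[A]^{\uparrow})\in\mathcal B(\mathbb L)$. Lifted maps $\mathcal B(\mathbb K)\to\mathcal B(\mathbb L)$: $\alpha^{\rightarrow}(A,B)=(\alpha[A]^{\uparrow\downarrow},\alpha[A]^{\uparrow})$, $\beta^{\rightarrow}(A,B)=(\beta[B]^{\downarrow},\beta[B]^{\downarrow\uparrow})$. **Doubly based lattices.** A doubly based lattice is a triple $(K,J,M)$ with $K$ a complete lattice, $J\subseteq K$ join-dense (every element of $K$ is a join of elements of $J$; "join-base") and $M\subseteq K$ meet-dense ("meet-base"). A $\mathbf{CLjm}^o$-morphism $(K,J,M)\to(L,H,N)$ is a pair $(\varphi,\psi)$ of maps $K\to L$ such that $\varphi$ preserves arbitrary joins and $\varphi[J]\subseteq H$, and $\psi$ preserves arbitrary meets and $\psi[M]\subseteq N$. A $\mathbf{CL}^o$-morphism is a map $\varphi:K\to L$ preserving arbitrary joins and meets with $\varphi[J]\subseteq H$ and $\varphi[M]\subseteq N$. **Functors.** $\mathcal B^{o}\mathbb K=(\mathcal B(\mathbb K),\gamma_{\mathbb K}[J],\mu_{\mathbb K}[M])$, $\mathcal B^{o}(\alpha,\beta)=(\alpha^{\rightarrow},\beta^{\rightarrow})$. $\mathcal C^{o}(K,J,M)=(J,M,\le)$,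 where $\le$ is the restriction of the order of $K$ to $J\times M$, and $\mathcal C^{o}(\varphi,\psi)=(\varphi|_J,\psi|_M)$. *)

theory Defs
  imports "HOL-Algebra.Complete_Lattice" "HOL-Library.FuncSet"
begin

section \<open>Categories, functors, equivalences\<close>

text \<open>Composition is indexed by three objects, so hom-sets need not be disjoint and an arrow need
  not carry its domain and codomain. \<open>cmp C X Y Z g f\<close> is \<open>g\<close> after \<open>f\<close>.\<close>

record ('o, 'm) cat =
  obj :: "'o set"
  hom :: "'o \<Rightarrow> 'o \<Rightarrow> 'm set"
  idt :: "'o \<Rightarrow> 'm"
  cmp :: "'o \<Rightarrow> 'o \<Rightarrow> 'o \<Rightarrow> 'm \<Rightarrow> 'm \<Rightarrow> 'm"

locale category =
  fixes C :: "('o, 'm) cat"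
  assumes idt_hom: "X \<in> obj C \<Longrightarrow> idt C X \<in> hom C X X"
    and cmp_hom: "\<lbrakk>X \<in> obj C; Y \<in> obj C; Z \<in> obj C; f \<in> hom C X Y; g \<in> hom C Y Z\<rbrakk>
      \<Longrightarrow> cmp C X Y Z g f \<in> hom C X Z"
    and cmp_idt_right: "\<lbrakk>X \<in> obj C; Y \<in> obj C; f \<in> hom C X Y\<rbrakk>
      \<Longrightarrow> cmp C X X Y f (idt C X) = f"
    and cmp_idt_left: "\<lbrakk>X \<in> obj C; Y \<in> obj C; f \<in> hom C X Y\<rbrakk>
      \<Longrightarrow> cmp C X Y Y (idt C Y) f = f"
    and cmp_assoc: "\<lbrakk>W \<in> obj C; X \<in> obj C; Y \<in> obj C; Z \<in> obj C;
        f \<in> hom C W X; g \<in> hom C X Y; h \<in> hom C Y Z\<rbrakk>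
      \<Longrightarrow> cmp C W X Z (cmp C X Y Z h g) f = cmp C W Y Z h (cmp C W X Y g f)"

record ('o, 'm, 'p, 'n) fctr =
  ob_map :: "'o \<Rightarrow> 'p"
  arr_map :: "'o \<Rightarrow> 'o \<Rightarrow> 'm \<Rightarrow> 'n"

locale functor_between = dom: category C + cod: category D
  for C :: "('o, 'm) cat" and D :: "('p, 'n) cat" +
  fixes F :: "('o, 'm, 'p, 'n) fctr"
  assumes ob_map_obj: "X \<in> obj C \<Longrightarrow> ob_map F X \<in> obj D"
    and arr_map_hom: "\<lbrakk>X \<in> obj C; Y \<in> obj C; f \<in> hom C X Y\<rbrakk>
      \<Longrightarrow> arr_map F X Y f \<in> hom D (ob_map F X) (ob_map F Y)"
    and arr_map_idt: "X \<in> obj C \<Longrightarrow> arr_map F X X (idt C X) = idt D (ob_map F X)"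
    and arr_map_cmp: "\<lbrakk>X \<in> obj C; Y \<in> obj C; Z \<in> obj C; f \<in> hom C X Y; g \<in> hom C Y Z\<rbrakk>
      \<Longrightarrow> arr_map F X Z (cmp C X Y Z g f) =
        cmp D (ob_map F X) (ob_map F Y) (ob_map F Z) (arr_map F Y Z g) (arr_map F X Y f)"

definition id_fctr :: "('o, 'm, 'o, 'm) fctr" where
  "id_fctr = \<lparr>ob_map = (\<lambda>X. X), arr_map = (\<lambda>X Y f. f)\<rparr>"

definition comp_fctr ::
  "('p, 'n, 'q, 'k) fctr \<Rightarrow> ('o, 'm, 'p, 'n) fctr \<Rightarrow> ('o, 'm, 'q, 'k) fctr" where
  "comp_fctr G F =
     \<lparr>ob_map = (\<lambda>X. ob_map G (ob_map F X)),
      arr_map = (\<lambda>X Y f. arr_map G (ob_map F X) (ob_map F Y) (arr_map F X Y f))\<rparr>"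

definition is_iso :: "('o, 'm) cat \<Rightarrow> 'o \<Rightarrow> 'o \<Rightarrow> 'm \<Rightarrow> bool" where
  "is_iso C X Y f \<longleftrightarrow> f \<in> hom C X Y \<and>
     (\<exists>g \<in> hom C Y X. cmp C X Y X g f = idt C X \<and> cmp C Y X Y f g = idt C Y)"

definition natural_iso ::
  "('o, 'm) cat \<Rightarrow> ('p, 'n) cat \<Rightarrow> ('o, 'm, 'p, 'n) fctr \<Rightarrow> ('o, 'm, 'p, 'n) fctr
    \<Rightarrow> ('o \<Rightarrow> 'n) \<Rightarrow> bool" where
  "natural_iso C D F G \<eta> \<longleftrightarrow>
     (\<forall>X \<in> obj C. is_iso D (ob_map F X) (ob_map G X) (\<eta> X)) \<and>
     (\<forall>X \<in> obj C. \<forall>Y \<in> obj C. \<forall>f \<in> hom C X Y.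
        cmp D (ob_map F X) (ob_map F Y) (ob_map G Y) (\<eta> Y) (arr_map F X Y f) =
        cmp D (ob_map F X) (ob_map G X) (ob_map G Y) (arr_map G X Y f) (\<eta> X))"

definition category_equivalence ::
  "('o, 'm) cat \<Rightarrow> ('p, 'n) cat \<Rightarrow> ('o, 'm, 'p, 'n) fctr \<Rightarrow> ('p, 'n, 'o, 'm) fctr \<Rightarrow> bool" where
  "category_equivalence C D F G \<longleftrightarrow>
     functor_between C D F \<and> functor_between D C G \<and>
     (\<exists>\<eta>. natural_iso C C id_fctr (comp_fctr G F) \<eta>) \<and>
     (\<exists>\<epsilon>. natural_iso D D (comp_fctr F G) id_fctr \<epsilon>)"


section \<open>Contexts and concepts\<close>

record ('a, 'b) fcontext =
  objs :: "'a set"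
  attrs :: "'b set"
  incid :: "('a \<times> 'b) set"

definition up :: "('a, 'b) fcontext \<Rightarrow> 'a set \<Rightarrow> 'b set" where
  "up K A = {m \<in> attrs K. \<forall>j \<in> A. (j, m) \<in> incid K}"

definition down :: "('a, 'b) fcontext \<Rightarrow> 'b set \<Rightarrow> 'a set" where
  "down K B = {j \<in> objs K. \<forall>m \<in> B. (j, m) \<in> incid K}"

definition extents :: "('a, 'b) fcontext \<Rightarrow> 'a set set" where
  "extents K = {A. A \<subseteq> objs K \<and> A = down K (up K A)}"

definition intents :: "('a, 'b) fcontext \<Rightarrow> 'b set set" where
  "intents K = {B. B \<subseteq> attrs K \<and> B = up K (down K B)}"

definition concepts :: "('a, 'b) fcontext \<Rightarrow> ('a set \<times> 'b set) set" where
  "concepts K = {(A, B). A \<subseteq> objs K \<and> B \<subseteq> attrs K \<and> A = down K B \<and> B = up K A}"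

definition concept_lattice :: "('a, 'b) fcontext \<Rightarrow> ('a set \<times> 'b set) gorder" where
  "concept_lattice K =
     \<lparr>carrier = concepts K, eq = (=), le = (\<lambda>c d. fst c \<subseteq> fst d)\<rparr>"

definition gamma :: "('a, 'b) fcontext \<Rightarrow> 'a \<Rightarrow> 'a set \<times> 'b set" where
  "gamma K j = (down K (up K {j}), up K {j})"

definition mu :: "('a, 'b) fcontext \<Rightarrow> 'b \<Rightarrow> 'a set \<times> 'b set" where
  "mu K m = (down K {m}, up K (down K {m}))"

definition purified_context :: "('a, 'b) fcontext \<Rightarrow> bool" where
  "purified_context K \<longleftrightarrow> incid K \<subseteq> objs K \<times> attrs K \<and>
     inj_on (gamma K) (objs K) \<and> inj_on (mu K) (attrs K)"

text \<open>Maps between sets are represented by extensional functions (\<open>\<rightarrow>\<^sub>E\<close>), so that equality of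
  morphisms is equality of maps on the given domain.\<close>

definition mapping_pairs ::
  "('a, 'b) fcontext \<Rightarrow> ('c, 'd) fcontext \<Rightarrow> (('a \<Rightarrow> 'c) \<times> ('b \<Rightarrow> 'd)) set" where
  "mapping_pairs K L = (objs K \<rightarrow>\<^sub>E objs L) \<times> (attrs K \<rightarrow>\<^sub>E attrs L)"

definition separately_continuous ::
  "('a, 'b) fcontext \<Rightarrow> ('c, 'd) fcontext \<Rightarrow> ('a \<Rightarrow> 'c) \<times> ('b \<Rightarrow> 'd) \<Rightarrow> bool" where
  "separately_continuous K L = (\<lambda>(\<alpha>, \<beta>).
     (\<forall>E \<in> extents L. \<alpha> -` E \<inter> objs K \<in> extents K) \<and>
     (\<forall>E \<in> intents L. \<beta> -` E \<inter> attrs K \<in> intents K))"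

definition conceptual ::
  "('a, 'b) fcontext \<Rightarrow> ('c, 'd) fcontext \<Rightarrow> ('a \<Rightarrow> 'c) \<times> ('b \<Rightarrow> 'd) \<Rightarrow> bool" where
  "conceptual K L = (\<lambda>(\<alpha>, \<beta>). separately_continuous K L (\<alpha>, \<beta>) \<and>
     (\<forall>(A, B) \<in> concepts K. (down L (\<beta> ` B), up L (\<alpha> ` A)) \<in> concepts L))"

definition alpha_lift ::
  "('c, 'd) fcontext \<Rightarrow> ('a \<Rightarrow> 'c) \<Rightarrow> 'a set \<times> 'b set \<Rightarrow> 'c set \<times> 'd set" where
  "alpha_lift L \<alpha> = (\<lambda>(A, B). (down L (up L (\<alpha> ` A)), up L (\<alpha> ` A)))"

definition beta_lift ::
  "('c, 'd) fcontext \<Rightarrow> ('b \<Rightarrow> 'd) \<Rightarrow> 'a set \<times> 'b set \<Rightarrow> 'c set \<times> 'd set" where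
  "beta_lift L \<beta> = (\<lambda>(A, B). (down L (\<beta> ` B), up L (down L (\<beta> ` B))))"


section \<open>Doubly based lattices\<close>

record 'a based_lattice =
  lat :: "'a gorder"
  jbase :: "'a set"
  mbase :: "'a set"

abbreviation lcarrier :: "'a based_lattice \<Rightarrow> 'a set" where
  "lcarrier X \<equiv> carrier (lat X)"

definition doubly_based_lattice :: "'a based_lattice \<Rightarrow> bool" where
  "doubly_based_lattice X \<longleftrightarrow>
     complete_lattice (lat X) \<and> jbase X \<subseteq> lcarrier X \<and> mbase X \<subseteq> lcarrier X \<and>
     (\<forall>x \<in> lcarrier X. \<exists>S \<subseteq> jbase X. x = \<Squnion>\<^bsub>lat X\<^esub> S) \<and>
     (\<forall>x \<in> lcarrier X. \<exists>S \<subseteq> mbase X. x = \<Sqinter>\<^bsub>lat X\<^esub> S)"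

definition preserves_joins :: "'a gorder \<Rightarrow> 'b gorder \<Rightarrow> ('a \<Rightarrow> 'b) \<Rightarrow> bool" where
  "preserves_joins K L \<phi> \<longleftrightarrow> (\<forall>S \<subseteq> carrier K. \<phi> (\<Squnion>\<^bsub>K\<^esub> S) = \<Squnion>\<^bsub>L\<^esub> (\<phi> ` S))"

definition preserves_meets :: "'a gorder \<Rightarrow> 'b gorder \<Rightarrow> ('a \<Rightarrow> 'b) \<Rightarrow> bool" where
  "preserves_meets K L \<phi> \<longleftrightarrow> (\<forall>S \<subseteq> carrier K. \<phi> (\<Sqinter>\<^bsub>K\<^esub> S) = \<Sqinter>\<^bsub>L\<^esub> (\<phi> ` S))"

definition CLjm_morphisms ::
  "'a based_lattice \<Rightarrow> 'b based_lattice \<Rightarrow> (('a \<Rightarrow> 'b) \<times> ('a \<Rightarrow> 'b)) set" where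
  "CLjm_morphisms X Y = {(\<phi>, \<psi>).
     \<phi> \<in> lcarrier X \<rightarrow>\<^sub>E lcarrier Y \<and> \<psi> \<in> lcarrier X \<rightarrow>\<^sub>E lcarrier Y \<and>
     preserves_joins (lat X) (lat Y) \<phi> \<and> \<phi> ` jbase X \<subseteq> jbase Y \<and>
     preserves_meets (lat X) (lat Y) \<psi> \<and> \<psi> ` mbase X \<subseteq> mbase Y}"

definition CL_morphisms :: "'a based_lattice \<Rightarrow> 'b based_lattice \<Rightarrow> ('a \<Rightarrow> 'b) set" where
  "CL_morphisms X Y = {\<phi>.
     \<phi> \<in> lcarrier X \<rightarrow>\<^sub>E lcarrier Y \<and>
     preserves_joins (lat X) (lat Y) \<phi> \<and> preserves_meets (lat X) (lat Y) \<phi> \<and>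
     \<phi> ` jbase X \<subseteq> jbase Y \<and> \<phi> ` mbase X \<subseteq> mbase Y}"

definition augmented_lattice :: "('a, 'b) fcontext \<Rightarrow> ('a set \<times> 'b set) based_lattice" where
  "augmented_lattice K =
     \<lparr>lat = concept_lattice K, jbase = gamma K ` objs K, mbase = mu K ` attrs K\<rparr>"

definition base_context :: "'a based_lattice \<Rightarrow> ('a, 'a) fcontext" where
  "base_context X =
     \<lparr>objs = jbase X, attrs = mbase X,
      incid = {(j, m). j \<in> jbase X \<and> m \<in> mbase X \<and> j \<sqsubseteq>\<^bsub>lat X\<^esub> m}\<rparr>"


section \<open>Universes\<close>

text \<open>The categories consist of all small contexts and lattices, for a notion of smallness
  on a type \<open>'u\<close>. In set theory a concept \<open>(A, B)\<close> of a small context is again a member of the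
  universe; in HOL it has the type \<open>'u set \<times> 'u set\<close>, and \<open>code\<close> plays the role of this inclusion.
  Closure of the small sets under power sets is not demanded: it would leave no provable
  instance with an infinite small set. Instead, a context is called small if its
  object set, its attribute set and its concept lattice are; lemma \<open>small_concepts\<close> below shows
  that the last condition is automatic when small sets are closed under power sets, and
  lemma \<open>ex_universe\<close> that every type embeds into a universe in which all sets of at most
  the size of that type are small. So up to bijection every context and every lattice, on whatever
  types, occurs in such a category.\<close>

locale universe =
  fixes small :: "'u set \<Rightarrow> bool" and code :: "'u set \<times> 'u set \<Rightarrow> 'u"
  assumes small_subset: "small A \<Longrightarrow> B \<subseteq> A \<Longrightarrow> small B"
    and small_image: "small A \<Longrightarrow> small (f ` A)"
    and code_inj: "inj_on code ({A. small A} \<times> {A. small A})"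

definition small_context ::
  "('u set \<Rightarrow> bool) \<Rightarrow> ('u set \<times> 'u set \<Rightarrow> 'u) \<Rightarrow> ('u, 'u) fcontext \<Rightarrow> bool" where
  "small_context small code K \<longleftrightarrow>
     small (objs K) \<and> small (attrs K) \<and> small (code ` concepts K)"

lemma (in universe) small_concepts:
  assumes pow: "\<And>A B. small A \<Longrightarrow> small B \<Longrightarrow> small (code ` (Pow A \<times> Pow B))"
  shows "small_context small code K \<longleftrightarrow> small (objs K) \<and> small (attrs K)"
proof -
  have "code ` concepts K \<subseteq> code ` (Pow (objs K) \<times> Pow (attrs K))"
    by (auto simp: concepts_def)
  then have "small (code ` concepts K)" if "small (objs K)" "small (attrs K)"
    using small_subset[OF pow[OF that]] by blast
  then show ?thesis
    unfolding small_context_def by blast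
qed

datatype 'k tree = Leaf 'k | Node "'k \<Rightarrow> 'k tree option" "'k \<Rightarrow> 'k tree option"

lemma ex_universe:
  "\<exists>(small :: 'k tree set \<Rightarrow> bool) code. universe small code \<and>
     inj (Leaf :: 'k \<Rightarrow> 'k tree) \<and> (\<forall>f :: 'k \<Rightarrow> 'k tree. small (range f))"
proof -
  define small :: "'k tree set \<Rightarrow> bool" where "small A \<longleftrightarrow> (\<exists>f :: 'k \<Rightarrow> 'k tree. A \<subseteq> range f)" for A
  define pick :: "'k tree set \<Rightarrow> 'k \<Rightarrow> 'k tree option" where
    "pick A = (SOME g. A = {x. Some x \<in> range g})" for A
  have pick: "A = {x. Some x \<in> range (pick A)}" if small: "small A" for A
  proof -
    from small obtain f :: "'k \<Rightarrow> 'k tree" where "A \<subseteq> range f"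
      by (auto simp: small_def)
    then have "A = {x. Some x \<in> range (\<lambda>k. if f k \<in> A then Some (f k) else None)}"
      by (force split: if_split_asm)
    then show ?thesis
      unfolding pick_def by (rule someI[where P = "\<lambda>g. A = {x. Some x \<in> range g}"])
  qed
  have "universe small (\<lambda>(A, B). Node (pick A) (pick B))"
  proof
    show "small B" if "small A" "B \<subseteq> A" for A B
      using that unfolding small_def by blast
    show "small (g ` A)" if "small A" for A and g :: "'k tree \<Rightarrow> 'k tree"
    proof -
      from that obtain f :: "'k \<Rightarrow> 'k tree" where "A \<subseteq> range f"
        by (auto simp: small_def)
      then have "g ` A \<subseteq> range (g \<circ> f)" by auto
      then show ?thesis unfolding small_def by blast
    qed
    show "inj_on (\<lambda>(A, B). Node (pick A) (pick B)) ({A. small A} \<times> {A. small A})"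
    proof (rule inj_onI, clarsimp)
      fix A B A' B'
      assume "small A" "small B" "small A'" "small B'" "pick A = pick A'" "pick B = pick B'"
      then show "A = A' \<and> B = B'" using pick by metis
    qed
  qed
  moreover have "inj (Leaf :: 'k \<Rightarrow> 'k tree)" by (simp add: inj_def)
  moreover have "small (range f)" for f :: "'k \<Rightarrow> 'k tree" by (auto simp: small_def)
  ultimately show ?thesis by blast
qed


section \<open>The four categories\<close>

definition Cjm ::
  "('u set \<Rightarrow> bool) \<Rightarrow> ('u set \<times> 'u set \<Rightarrow> 'u)
    \<Rightarrow> (('u, 'u) fcontext, ('u \<Rightarrow> 'u) \<times> ('u \<Rightarrow> 'u)) cat" where
  "Cjm small code =
     \<lparr>obj = {K. purified_context K \<and> small_context small code K},
      hom = (\<lambda>K L. {p \<in> mapping_pairs K L. separately_continuous K L p}),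
      idt = (\<lambda>K. (\<lambda>j \<in> objs K. j, \<lambda>m \<in> attrs K. m)),
      cmp = (\<lambda>K L N (\<alpha>', \<beta>') (\<alpha>, \<beta>). (compose (objs K) \<alpha>' \<alpha>, compose (attrs K) \<beta>' \<beta>))\<rparr>"

definition Cc ::
  "('u set \<Rightarrow> bool) \<Rightarrow> ('u set \<times> 'u set \<Rightarrow> 'u)
    \<Rightarrow> (('u, 'u) fcontext, ('u \<Rightarrow> 'u) \<times> ('u \<Rightarrow> 'u)) cat" where
  "Cc small code =
     (Cjm small code)\<lparr>hom := (\<lambda>K L. {p \<in> mapping_pairs K L. conceptual K L p})\<rparr>"

definition CLjm ::
  "('u set \<Rightarrow> bool) \<Rightarrow> ('u based_lattice, ('u \<Rightarrow> 'u) \<times> ('u \<Rightarrow> 'u)) cat" where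
  "CLjm small =
     \<lparr>obj = {X. doubly_based_lattice X \<and> small (lcarrier X)},
      hom = CLjm_morphisms,
      idt = (\<lambda>X. (\<lambda>x \<in> lcarrier X. x, \<lambda>x \<in> lcarrier X. x)),
      cmp = (\<lambda>X Y Z (\<phi>', \<psi>') (\<phi>, \<psi>). (compose (lcarrier X) \<phi>' \<phi>, compose (lcarrier X) \<psi>' \<psi>))\<rparr>"

definition CL :: "('u set \<Rightarrow> bool) \<Rightarrow> ('u based_lattice, 'u \<Rightarrow> 'u) cat" where
  "CL small =
     \<lparr>obj = {X. doubly_based_lattice X \<and> small (lcarrier X)},
      hom = CL_morphisms,
      idt = (\<lambda>X. \<lambda>x \<in> lcarrier X. x),
      cmp = (\<lambda>X Y Z \<phi>' \<phi>. compose (lcarrier X) \<phi>' \<phi>)\<rparr>"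


section \<open>The functors\<close>

definition rename_lattice :: "('a \<Rightarrow> 'b) \<Rightarrow> 'a based_lattice \<Rightarrow> 'b based_lattice" where
  "rename_lattice e X =
     \<lparr>lat = \<lparr>carrier = e ` lcarrier X, eq = (=),
        le = (\<lambda>x y. inv_into (lcarrier X) e x \<sqsubseteq>\<^bsub>lat X\<^esub> inv_into (lcarrier X) e y)\<rparr>,
      jbase = e ` jbase X, mbase = e ` mbase X\<rparr>"

definition rename_map :: "('a \<Rightarrow> 'b) \<Rightarrow> 'a based_lattice \<Rightarrow> ('a \<Rightarrow> 'a) \<Rightarrow> 'b \<Rightarrow> 'b" where
  "rename_map e X f = (\<lambda>x \<in> e ` lcarrier X. e (f (inv_into (lcarrier X) e x)))"

definition Bo_jm :: "('u set \<times> 'u set \<Rightarrow> 'u)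
    \<Rightarrow> (('u, 'u) fcontext, ('u \<Rightarrow> 'u) \<times> ('u \<Rightarrow> 'u),
        'u based_lattice, ('u \<Rightarrow> 'u) \<times> ('u \<Rightarrow> 'u)) fctr" where
  "Bo_jm code =
     \<lparr>ob_map = (\<lambda>K. rename_lattice code (augmented_lattice K)),
      arr_map = (\<lambda>K L (\<alpha>, \<beta>).
        (rename_map code (augmented_lattice K) (alpha_lift L \<alpha>),
         rename_map code (augmented_lattice K) (beta_lift L \<beta>)))\<rparr>"

definition Co_jm :: "('u based_lattice, ('u \<Rightarrow> 'u) \<times> ('u \<Rightarrow> 'u),
    ('u, 'u) fcontext, ('u \<Rightarrow> 'u) \<times> ('u \<Rightarrow> 'u)) fctr" where
  "Co_jm =
     \<lparr>ob_map = base_context,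
      arr_map = (\<lambda>X Y (\<phi>, \<psi>). (restrict \<phi> (jbase X), restrict \<psi> (mbase X)))\<rparr>"

text \<open>For a conceptual pair \<open>(\<alpha>, \<beta>)\<close> both lifted maps send \<open>(A, B)\<close> to the concept
  \<open>(\<beta>[B]\<^sup>\<down>, \<alpha>[A]\<^sup>\<up>)\<close>, so they coincide and either of them is the value of the functor; a complete
  homomorphism \<open>\<phi>\<close> is identified with the pair \<open>(\<phi>, \<phi>)\<close>.\<close>

definition Bo_c :: "('u set \<times> 'u set \<Rightarrow> 'u)
    \<Rightarrow> (('u, 'u) fcontext, ('u \<Rightarrow> 'u) \<times> ('u \<Rightarrow> 'u), 'u based_lattice, 'u \<Rightarrow> 'u) fctr" where
  "Bo_c code =
     \<lparr>ob_map = ob_map (Bo_jm code),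
      arr_map = (\<lambda>K L p. fst (arr_map (Bo_jm code) K L p))\<rparr>"

definition Co_c :: "('u based_lattice, 'u \<Rightarrow> 'u,
    ('u, 'u) fcontext, ('u \<Rightarrow> 'u) \<times> ('u \<Rightarrow> 'u)) fctr" where
  "Co_c =
     \<lparr>ob_map = ob_map Co_jm,
      arr_map = (\<lambda>X Y \<phi>. arr_map Co_jm X Y (\<phi>, \<phi>))\<rparr>"

lemma conceptual_lifts_eq:
  assumes "conceptual K L (\<alpha>, \<beta>)" and "c \<in> concepts K"
  shows "alpha_lift L \<alpha> c = beta_lift L \<beta> c"
proof (cases c)
  case (Pair A B)
  from assms(1) have "\<forall>(A, B) \<in> concepts K. (down L (\<beta> ` B), up L (\<alpha> ` A)) \<in> concepts L"
    unfolding conceptual_def case_prod_conv by (rule conjunct2)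
  from bspec[OF this assms(2)] Pair have "(down L (\<beta> ` B), up L (\<alpha> ` A)) \<in> concepts L"
    by (simp only: case_prod_conv)
  then have lifts: "down L (\<beta> ` B) = down L (up L (\<alpha> ` A))"
      "up L (\<alpha> ` A) = up L (down L (\<beta> ` B))"
    unfolding concepts_def mem_Collect_eq case_prod_conv by blast+
  show ?thesis
    unfolding Pair alpha_lift_def beta_lift_def case_prod_conv lifts(2)[symmetric]
    by (simp only: lifts(1))
qed

end

theory Submission
  imports Defs
begin

text \<open>The functor \<open>\<C>\<^sup>o\<close> is shown to be full, faithful and, up to the isomorphism
  \<open>(\<gamma>, \<mu>) : \<K> \<rightarrow> \<C>\<^sup>o \<B>\<^sup>o \<K>\<close>, surjective on objects. The extents of \<open>(J, M, \<le>)\<close> are the sets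
  \<open>J \<inter> \<down>x\<close>, so \<open>\<alpha>\<close> pulls extents back to extents iff \<open>x \<mapsto> \<Squnion> \<alpha>[J \<inter> \<down>x]\<close> has an upper adjoint, that
  is, preserves joins; intents and meets are dual. This extension is unique as \<open>J\<close> is join-dense.
  The pair \<open>(\<alpha>, \<beta>)\<close> is conceptual iff its two extensions agree. Hence \<open>\<B>\<^sup>o(\<alpha>, \<beta>)\<close> is the only pair of
  join- and meet-preserving maps that \<open>(\<gamma>, \<mu>)\<close> intertwines with \<open>(\<alpha>, \<beta>)\<close>; functoriality of \<open>\<B>\<^sup>o\<close>,
  naturality and the counit all follow formally from this.\<close>

section \<open>Equivalences from full and faithful functors\<close>

text \<open>The work is placed on the functor C^o because restriction to the bases composes
  transparently, whereas the values of B^o are closures of images transported along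
  \<open>code\<close>, and composing them directly would mean comparing closures of images of
  closures. The formal step rests on the shape of the assumption \<open>F_arr\<close>: it says only
  that a morphism closing the square with the unit must be the value of F. Fullness of G supplies
  such a morphism, and identities and composites close their squares, whence the functor laws for F.

  Half of the lattice theory is obtained by reversing the order, which exchanges the two bases and
  transposes the context; so extents and joins are treated, and intents and meets are read off.

  Both equivalences use the same unit, since an isomorphism of contexts is conceptual. They differ
  because the concept of x is sent to the extent of \<psi> x paired with the intent of \<phi> x, and
  these form a concept only if the two elements coincide.\<close>

lemma category_equivalenceI:
  fixes C :: "('o, 'm) cat" and D :: "('p, 'n) cat"
    and F :: "('o, 'm, 'p, 'n) fctr" and G :: "('p, 'n, 'o, 'm) fctr" and \<eta> :: "'o \<Rightarrow> 'm"
  assumes G: "functor_between D C G"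
    and faithful: "\<And>X Y f g. \<lbrakk>X \<in> obj D; Y \<in> obj D; f \<in> hom D X Y; g \<in> hom D X Y;
        arr_map G X Y f = arr_map G X Y g\<rbrakk> \<Longrightarrow> f = g"
    and full: "\<And>X Y f. \<lbrakk>X \<in> obj D; Y \<in> obj D; f \<in> hom C (ob_map G X) (ob_map G Y)\<rbrakk>
        \<Longrightarrow> \<exists>h \<in> hom D X Y. arr_map G X Y h = f"
    and F_obj: "\<And>X. X \<in> obj C \<Longrightarrow> ob_map F X \<in> obj D"
    and \<eta>: "\<And>X. X \<in> obj C \<Longrightarrow> is_iso C X (ob_map G (ob_map F X)) (\<eta> X)"
    and F_arr: "\<And>X Y f h. \<lbrakk>X \<in> obj C; Y \<in> obj C; f \<in> hom C X Y; h \<in> hom D (ob_map F X) (ob_map F Y);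
        cmp C X (ob_map G (ob_map F X)) (ob_map G (ob_map F Y))
          (arr_map G (ob_map F X) (ob_map F Y) h) (\<eta> X) =
        cmp C X Y (ob_map G (ob_map F Y)) (\<eta> Y) f\<rbrakk> \<Longrightarrow> arr_map F X Y f = h"
  shows "category_equivalence C D F G"
proof -
  interpret G: functor_between D C G by fact
  let ?F = "ob_map F" and ?G = "ob_map G"
  let ?Fa = "arr_map F" and ?Ga = "arr_map G"
  note F_obj[simp] G.ob_map_obj[simp] G.cod.cmp_hom[simp] G.dom.cmp_hom[simp]
    G.arr_map_hom[simp] G.cod.idt_hom[simp] G.dom.idt_hom[simp]
  have "\<exists>\<eta>'. \<forall>X \<in> obj C. \<eta>' X \<in> hom C (?G (?F X)) X \<and>
      cmp C X (?G (?F X)) X (\<eta>' X) (\<eta> X) = idt C X \<and>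
      cmp C (?G (?F X)) X (?G (?F X)) (\<eta> X) (\<eta>' X) = idt C (?G (?F X))"
    by (rule bchoice) (use \<eta> in \<open>auto simp: is_iso_def\<close>)
  then obtain \<eta>' where \<eta>'[simp]: "\<And>X. X \<in> obj C \<Longrightarrow> \<eta>' X \<in> hom C (?G (?F X)) X"
      "\<And>X. X \<in> obj C \<Longrightarrow> cmp C X (?G (?F X)) X (\<eta>' X) (\<eta> X) = idt C X"
      "\<And>X. X \<in> obj C \<Longrightarrow> cmp C (?G (?F X)) X (?G (?F X)) (\<eta> X) (\<eta>' X) = idt C (?G (?F X))"
    by auto
  have \<eta>_hom[simp]: "\<eta> X \<in> hom C X (?G (?F X))" if "X \<in> obj C" for X
    using \<eta>[OF that] by (simp add: is_iso_def)
  have F: "?Fa X Y f \<in> hom D (?F X) (?F Y) \<and>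
      cmp C X (?G (?F X)) (?G (?F Y)) (?Ga (?F X) (?F Y) (?Fa X Y f)) (\<eta> X) =
      cmp C X Y (?G (?F Y)) (\<eta> Y) f"
    if XY: "X \<in> obj C" "Y \<in> obj C" and f: "f \<in> hom C X Y" for X Y f
  proof -
    \<comment> \<open>The conjugate of \<open>f\<close> by the isomorphisms \<open>\<eta>\<close>. A
      preimage of it under the full functor closes the square, so \<open>F_arr\<close> recognises
      that preimage as the value of F on \<open>f\<close>.\<close>
    let ?f = "cmp C (?G (?F X)) Y (?G (?F Y)) (\<eta> Y) (cmp C (?G (?F X)) X Y f (\<eta>' X))"
    obtain h where h: "h \<in> hom D (?F X) (?F Y)" "?Ga (?F X) (?F Y) h = ?f"
      using full[of "?F X" "?F Y" ?f] XY f by auto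
    have "cmp C X (?G (?F X)) (?G (?F Y)) ?f (\<eta> X) =
        cmp C X Y (?G (?F Y)) (\<eta> Y) (cmp C X (?G (?F X)) Y (cmp C (?G (?F X)) X Y f (\<eta>' X)) (\<eta> X))"
      by (rule G.cod.cmp_assoc) (use XY f in simp_all)
    also have "cmp C X (?G (?F X)) Y (cmp C (?G (?F X)) X Y f (\<eta>' X)) (\<eta> X) = f"
      using XY f by (simp add: G.cod.cmp_assoc[of X "?G (?F X)" X Y] G.cod.cmp_idt_right)
    finally have comm: "cmp C X (?G (?F X)) (?G (?F Y)) (?Ga (?F X) (?F Y) h) (\<eta> X) =
        cmp C X Y (?G (?F Y)) (\<eta> Y) f"
      by (simp add: h)
    from F_arr[OF XY f h(1) comm] h comm show ?thesis by simp
  qed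
  note F_hom[simp] = F[THEN conjunct1] and F_nat = F[THEN conjunct2]
  have functor_F: "functor_between C D F"
  proof
    fix X assume X: "X \<in> obj C"
    then show "?Fa X X (idt C X) = idt D (?F X)"
      by (intro F_arr) (simp_all add: G.arr_map_idt G.cod.cmp_idt_right G.cod.cmp_idt_left)
  next
    fix X Y Z f g
    assume XYZ: "X \<in> obj C" "Y \<in> obj C" "Z \<in> obj C" and f: "f \<in> hom C X Y" and g: "g \<in> hom C Y Z"
    let ?Gf = "?Ga (?F X) (?F Y) (?Fa X Y f)" and ?Gg = "?Ga (?F Y) (?F Z) (?Fa Y Z g)"
    \<comment> \<open>Pasting the squares of \<open>f\<close> and \<open>g\<close>: the composite of
      the two values of F closes the square of the composite, and \<open>F_arr\<close> applies to
      it.\<close>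
    have "cmp C X (?G (?F X)) (?G (?F Z)) (cmp C (?G (?F X)) (?G (?F Y)) (?G (?F Z)) ?Gg ?Gf) (\<eta> X)
        = cmp C X (?G (?F Y)) (?G (?F Z)) ?Gg (cmp C X (?G (?F X)) (?G (?F Y)) ?Gf (\<eta> X))"
      by (rule G.cod.cmp_assoc) (use XYZ f g in simp_all)
    also have "\<dots> = cmp C X (?G (?F Y)) (?G (?F Z)) ?Gg (cmp C X Y (?G (?F Y)) (\<eta> Y) f)"
      using XYZ f by (simp add: F_nat)
    also have "\<dots> = cmp C X Y (?G (?F Z)) (cmp C Y (?G (?F Y)) (?G (?F Z)) ?Gg (\<eta> Y)) f"
      by (rule G.cod.cmp_assoc[symmetric]) (use XYZ f g in simp_all)
    also have "\<dots> = cmp C X Y (?G (?F Z)) (cmp C Y Z (?G (?F Z)) (\<eta> Z) g) f"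
      using XYZ g by (simp add: F_nat)
    also have "\<dots> = cmp C X Z (?G (?F Z)) (\<eta> Z) (cmp C X Y Z g f)"
      by (rule G.cod.cmp_assoc) (use XYZ f g in simp_all)
    finally show "?Fa X Z (cmp C X Y Z g f) = cmp D (?F X) (?F Y) (?F Z) (?Fa Y Z g) (?Fa X Y f)"
      using XYZ f g by (intro F_arr) (simp_all add: G.arr_map_cmp)
  qed simp_all
  have unit: "natural_iso C C id_fctr (comp_fctr G F) \<eta>"
    using \<eta> by (simp add: natural_iso_def id_fctr_def comp_fctr_def F_nat)
  \<comment> \<open>The counit is chosen over the inverse of the unit at \<open>?G X\<close>. A
    morphism over the unit itself is then its inverse, because faithfulness lifts both
    identities.\<close>
  have "\<exists>\<epsilon>. \<forall>X \<in> obj D. \<epsilon> X \<in> hom D (?F (?G X)) X \<and> ?Ga (?F (?G X)) X (\<epsilon> X) = \<eta>' (?G X)"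
    by (rule bchoice) (use full in \<open>simp add: Bex_def[symmetric]\<close>)
  then obtain \<epsilon> where \<epsilon>[simp]: "\<And>X. X \<in> obj D \<Longrightarrow> \<epsilon> X \<in> hom D (?F (?G X)) X"
      "\<And>X. X \<in> obj D \<Longrightarrow> ?Ga (?F (?G X)) X (\<epsilon> X) = \<eta>' (?G X)"
    by auto
  have \<epsilon>_iso: "is_iso D (?F (?G X)) X (\<epsilon> X)" if X: "X \<in> obj D" for X
  proof -
    obtain \<delta> where \<delta>: "\<delta> \<in> hom D X (?F (?G X))" "?Ga X (?F (?G X)) \<delta> = \<eta> (?G X)"
      using full[of X "?F (?G X)" "\<eta> (?G X)"] X by auto
    have "cmp D (?F (?G X)) X (?F (?G X)) \<delta> (\<epsilon> X) = idt D (?F (?G X))"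
      by (rule faithful[of "?F (?G X)" "?F (?G X)"])
        (use X \<delta> in \<open>simp_all add: G.arr_map_cmp G.arr_map_idt\<close>)
    moreover have "cmp D X (?F (?G X)) X (\<epsilon> X) \<delta> = idt D X"
      by (rule faithful[of X X]) (use X \<delta> in \<open>simp_all add: G.arr_map_cmp G.arr_map_idt\<close>)
    ultimately show ?thesis
      using X \<delta> by (auto simp: is_iso_def)
  qed
  have \<epsilon>_nat: "cmp D (?F (?G X)) (?F (?G Y)) Y (\<epsilon> Y) (?Fa (?G X) (?G Y) (?Ga X Y f)) =
      cmp D (?F (?G X)) X Y f (\<epsilon> X)"
    if XY: "X \<in> obj D" "Y \<in> obj D" and f: "f \<in> hom D X Y" for X Y f
  proof (rule faithful[of "?F (?G X)" Y])
    let ?x = "?G X" and ?y = "?G Y" and ?f = "?Ga X Y f"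
    let ?X = "?G (?F ?x)" and ?Y = "?G (?F ?y)"
    let ?h = "?Ga (?F ?x) (?F ?y) (?Fa ?x ?y ?f)"
    \<comment> \<open>After applying G the claim is naturality of the inverses
      \<open>\<eta>'\<close>: \<open>?h\<close> is the conjugate of \<open>?f\<close>, and composing
      with \<open>\<eta>' ?y\<close> cancels the outer factor \<open>\<eta> ?y\<close>.\<close>
    have "?h = cmp C ?X ?x ?Y (cmp C ?x ?X ?Y ?h (\<eta> ?x)) (\<eta>' ?x)"
      using XY f by (simp add: G.cod.cmp_assoc[of ?X ?x ?X ?Y] G.cod.cmp_idt_right)
    also have "\<dots> = cmp C ?X ?x ?Y (cmp C ?x ?y ?Y (\<eta> ?y) ?f) (\<eta>' ?x)"
      using XY f by (simp add: F_nat)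
    also have "\<dots> = cmp C ?X ?y ?Y (\<eta> ?y) (cmp C ?X ?x ?y ?f (\<eta>' ?x))"
      by (rule G.cod.cmp_assoc) (use XY f in simp_all)
    finally have "cmp C ?X ?Y ?y (\<eta>' ?y) ?h =
        cmp C ?X ?Y ?y (\<eta>' ?y) (cmp C ?X ?y ?Y (\<eta> ?y) (cmp C ?X ?x ?y ?f (\<eta>' ?x)))"
      by simp
    also have "\<dots> = cmp C ?X ?y ?y (cmp C ?y ?Y ?y (\<eta>' ?y) (\<eta> ?y)) (cmp C ?X ?x ?y ?f (\<eta>' ?x))"
      by (rule G.cod.cmp_assoc[symmetric]) (use XY f in simp_all)
    also have "\<dots> = cmp C ?X ?x ?y ?f (\<eta>' ?x)"
      using XY f by (simp add: G.cod.cmp_idt_left)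
    finally show "?Ga (?F ?x) Y (cmp D (?F ?x) (?F ?y) Y (\<epsilon> Y) (?Fa ?x ?y ?f)) =
        ?Ga (?F ?x) Y (cmp D (?F ?x) X Y f (\<epsilon> X))"
      using XY f by (simp add: G.arr_map_cmp)
  qed (use XY f in simp_all)
  have "natural_iso D D (comp_fctr F G) id_fctr \<epsilon>"
    using \<epsilon>_iso \<epsilon>_nat by (simp add: natural_iso_def id_fctr_def comp_fctr_def)
  with functor_F G unit show ?thesis
    unfolding category_equivalence_def by blast
qed

section \<open>Doubly based lattices and their contexts\<close>

text \<open>Together with \<open>dual_based\<close> this turns statements about extents, joins and
  join-bases into those about intents, meets and meet-bases; \<open>base_context_dual\<close> ties
  the two dualities together.\<close>

definition dual_context :: "('a, 'b) fcontext \<Rightarrow> ('b, 'a) fcontext" where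
  "dual_context K = \<lparr>objs = attrs K, attrs = objs K, incid = (incid K)\<inverse>\<rparr>"

definition dual_based :: "'a based_lattice \<Rightarrow> 'a based_lattice" where
  "dual_based X = \<lparr>lat = inv_gorder (lat X), jbase = mbase X, mbase = jbase X\<rparr>"

lemma dual_context_simps [simp]:
  "objs (dual_context K) = attrs K" "attrs (dual_context K) = objs K"
  "up (dual_context K) = down K" "down (dual_context K) = up K"
  "extents (dual_context K) = intents K" "intents (dual_context K) = extents K"
proof -
  show updown: "up (dual_context K) = down K" "down (dual_context K) = up K"
    by (auto simp: up_def down_def dual_context_def fun_eq_iff)
  show "extents (dual_context K) = intents K" "intents (dual_context K) = extents K"
    by (simp_all add: extents_def intents_def updown) (simp_all add: dual_context_def)
qed (simp_all add: dual_context_def)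

lemma dual_based_simps [simp]:
  "lat (dual_based X) = inv_gorder (lat X)"
  "jbase (dual_based X) = mbase X" "mbase (dual_based X) = jbase X"
  by (simp_all add: dual_based_def)

lemma base_context_simps [simp]:
  "objs (base_context X) = jbase X" "attrs (base_context X) = mbase X"
  by (simp_all add: base_context_def)

lemma base_context_dual: "base_context (dual_based X) = dual_context (base_context X)"
  by (auto simp: base_context_def dual_context_def)

lemma preserves_joins_dual [simp]:
  "preserves_joins (inv_gorder K) (inv_gorder L) f = preserves_meets K L f"
  by (simp add: preserves_joins_def preserves_meets_def)

section \<open>The Galois connection of a context\<close>

lemma up_subset: "up K A \<subseteq> attrs K" and down_subset: "down K B \<subseteq> objs K"
  by (auto simp: up_def down_def)

lemma subset_down_iff: "A \<subseteq> objs K \<Longrightarrow> B \<subseteq> attrs K \<Longrightarrow> A \<subseteq> down K B \<longleftrightarrow> B \<subseteq> up K A"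
  by (auto simp: up_def down_def)

lemma up_down_up: "A \<subseteq> objs K \<Longrightarrow> up K (down K (up K A)) = up K A"
  and down_up_down: "B \<subseteq> attrs K \<Longrightarrow> down K (up K (down K B)) = down K B"
  by (auto simp: up_def down_def)

text \<open>Closed sets are the images of the Galois connection, since \<open>down K B\<close> is
  unchanged by a further closure. In this form an extent comes with a set of attributes to compute
  with.\<close>

lemma extents_eq: "extents K = down K ` Pow (attrs K)"
proof (intro equalityI subsetI)
  fix A assume "A \<in> extents K"
  then have "A = down K (up K A)" "up K A \<in> Pow (attrs K)"
    by (auto simp: extents_def up_def)
  then show "A \<in> down K ` Pow (attrs K)" by blast
next
  fix A assume "A \<in> down K ` Pow (attrs K)"
  then show "A \<in> extents K"
    using down_subset[of K] by (auto simp: extents_def down_up_down subset_iff)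
qed

lemma concepts_eq: "concepts K = (\<lambda>A. (A, up K A)) ` extents K"
  by (auto simp: concepts_def extents_def up_def)

section \<open>Complete lattices: joins, meets and adjoints\<close>

lemma complete_latticeI_sup_inf:
  assumes "partial_order L"
    and sup: "\<And>S. S \<subseteq> carrier L \<Longrightarrow>
      \<exists>s \<in> carrier L. \<forall>y \<in> carrier L. s \<sqsubseteq>\<^bsub>L\<^esub> y \<longleftrightarrow> (\<forall>x \<in> S. x \<sqsubseteq>\<^bsub>L\<^esub> y)"
    and inf: "\<And>S. S \<subseteq> carrier L \<Longrightarrow>
      \<exists>s \<in> carrier L. \<forall>y \<in> carrier L. y \<sqsubseteq>\<^bsub>L\<^esub> s \<longleftrightarrow> (\<forall>x \<in> S. y \<sqsubseteq>\<^bsub>L\<^esub> x)"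
  shows "complete_lattice L"
proof -
  interpret partial_order L by fact
  show ?thesis
  proof (rule complete_latticeI)
    fix S assume S: "S \<subseteq> carrier L"
    obtain s where s: "s \<in> carrier L" "\<forall>y \<in> carrier L. s \<sqsubseteq>\<^bsub>L\<^esub> y \<longleftrightarrow> (\<forall>x \<in> S. x \<sqsubseteq>\<^bsub>L\<^esub> y)"
      using sup[OF S] by blast
    then have "\<forall>x \<in> S. x \<sqsubseteq>\<^bsub>L\<^esub> s" by blast
    with s S have "least L s (Upper L S)"
      unfolding least_def Upper_def by auto
    then show "\<exists>s. least L s (Upper L S)" ..
    obtain t where t: "t \<in> carrier L" "\<forall>y \<in> carrier L. y \<sqsubseteq>\<^bsub>L\<^esub> t \<longleftrightarrow> (\<forall>x \<in> S. y \<sqsubseteq>\<^bsub>L\<^esub> x)"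
      using inf[OF S] by blast
    then have "\<forall>x \<in> S. t \<sqsubseteq>\<^bsub>L\<^esub> x" by blast
    with t S have "greatest L t (Lower L S)"
      unfolding greatest_def Lower_def by auto
    then show "\<exists>i. greatest L i (Lower L S)" ..
  qed
qed

context complete_lattice
begin

lemma sup_le_iff: "S \<subseteq> carrier L \<Longrightarrow> y \<in> carrier L \<Longrightarrow> \<Squnion>S \<sqsubseteq> y \<longleftrightarrow> (\<forall>x \<in> S. x \<sqsubseteq> y)"
  by (meson sup_upper sup_least sup_closed le_trans subsetD)

lemma inf_ge_iff: "S \<subseteq> carrier L \<Longrightarrow> y \<in> carrier L \<Longrightarrow> y \<sqsubseteq> \<Sqinter>S \<longleftrightarrow> (\<forall>x \<in> S. y \<sqsubseteq> x)"
  by (meson inf_lower inf_greatest inf_closed le_trans subsetD)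

lemma sup_eqI:
  assumes "S \<subseteq> carrier L" "s \<in> carrier L"
    and "\<And>y. y \<in> carrier L \<Longrightarrow> s \<sqsubseteq> y \<longleftrightarrow> (\<forall>x \<in> S. x \<sqsubseteq> y)"
  shows "\<Squnion>S = s"
  using assms by (metis le_antisym le_refl sup_closed sup_le_iff)

lemma inf_eqI:
  assumes "S \<subseteq> carrier L" "s \<in> carrier L"
    and "\<And>y. y \<in> carrier L \<Longrightarrow> y \<sqsubseteq> s \<longleftrightarrow> (\<forall>x \<in> S. y \<sqsubseteq> x)"
  shows "\<Sqinter>S = s"
  using assms by (metis le_antisym le_refl inf_closed inf_ge_iff)

lemma dual_complete_lattice: "complete_lattice (inv_gorder L)"
  by (rule complete_lattice.intro[OF dual_order])
    (unfold_locales, simp_all add: inf_exists sup_exists)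

end

text \<open>The adjoint functor theorem for posets. It is the bridge to continuity: the value of the
  upper adjoint at \<open>y\<close> is the element whose trace on the join-base is the preimage of
  the extent belonging to \<open>y\<close>.\<close>

lemma preserves_joins_adjoint:
  assumes K: "complete_lattice K" and L: "complete_lattice L"
    and f: "f \<in> carrier K \<rightarrow> carrier L"
  shows "preserves_joins K L f \<longleftrightarrow>
    (\<forall>y \<in> carrier L. \<exists>z \<in> carrier K. \<forall>x \<in> carrier K. f x \<sqsubseteq>\<^bsub>L\<^esub> y \<longleftrightarrow> x \<sqsubseteq>\<^bsub>K\<^esub> z)"
proof -
  interpret K: complete_lattice K by fact
  interpret L: complete_lattice L by fact
  show ?thesis
  proof (intro iffI ballI)
    fix y assume f_sup: "preserves_joins K L f" and y: "y \<in> carrier L"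
    \<comment> \<open>The adjoint must send \<open>y\<close> to the largest element mapped below
      \<open>y\<close>. The join of all candidates is again a candidate because \<open>f\<close>
      preserves it.\<close>
    let ?S = "{x \<in> carrier K. f x \<sqsubseteq>\<^bsub>L\<^esub> y}"
    let ?z = "\<Squnion>\<^bsub>K\<^esub> ?S"
    have z: "?z \<in> carrier K" by (rule K.sup_closed) auto
    have "f ?z = \<Squnion>\<^bsub>L\<^esub> (f ` ?S)"
      using f_sup by (auto simp: preserves_joins_def)
    also have "\<dots> \<sqsubseteq>\<^bsub>L\<^esub> y"
      using f y by (subst L.sup_le_iff) auto
    finally have fz: "f ?z \<sqsubseteq>\<^bsub>L\<^esub> y" .
    \<comment> \<open>Monotonicity is extracted from preservation of the join of a comparable
      pair.\<close>
    have mono: "f x \<sqsubseteq>\<^bsub>L\<^esub> f ?z" if x: "x \<in> carrier K" "x \<sqsubseteq>\<^bsub>K\<^esub> ?z" for x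
    proof -
      have "\<Squnion>\<^bsub>K\<^esub> {x, ?z} = ?z"
        by (rule K.sup_eqI) (use x z in \<open>auto intro: K.le_trans[OF x(2)]\<close>)
      moreover have "f (\<Squnion>\<^bsub>K\<^esub> {x, ?z}) = \<Squnion>\<^bsub>L\<^esub> (f ` {x, ?z})"
        using f_sup x z by (auto simp: preserves_joins_def)
      ultimately show ?thesis
        using L.sup_upper[of "f ` {x, ?z}" "f x"] funcset_mem[OF f x(1)] funcset_mem[OF f z]
        by simp
    qed
    have "f x \<sqsubseteq>\<^bsub>L\<^esub> y \<longleftrightarrow> x \<sqsubseteq>\<^bsub>K\<^esub> ?z" if x: "x \<in> carrier K" for x
      using mono[OF x] L.le_trans[OF _ fz funcset_mem[OF f x] funcset_mem[OF f z] y]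
        x K.sup_upper[of ?S x] by blast
    then show "\<exists>z \<in> carrier K. \<forall>x \<in> carrier K. f x \<sqsubseteq>\<^bsub>L\<^esub> y \<longleftrightarrow> x \<sqsubseteq>\<^bsub>K\<^esub> z"
      using z by blast
  next
    assume adj: "\<forall>y \<in> carrier L. \<exists>z \<in> carrier K. \<forall>x \<in> carrier K. f x \<sqsubseteq>\<^bsub>L\<^esub> y \<longleftrightarrow> x \<sqsubseteq>\<^bsub>K\<^esub> z"
    show "preserves_joins K L f"
      unfolding preserves_joins_def
    proof (intro allI impI)
      fix S assume S: "S \<subseteq> carrier K"
      have "\<Squnion>\<^bsub>L\<^esub> (f ` S) = f (\<Squnion>\<^bsub>K\<^esub> S)"
      proof (rule L.sup_eqI)
        fix y assume y: "y \<in> carrier L"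
        obtain z where z: "z \<in> carrier K"
            "\<forall>x \<in> carrier K. f x \<sqsubseteq>\<^bsub>L\<^esub> y \<longleftrightarrow> x \<sqsubseteq>\<^bsub>K\<^esub> z"
          using bspec[OF adj y] by (rule bexE)
        have "f (\<Squnion>\<^bsub>K\<^esub> S) \<sqsubseteq>\<^bsub>L\<^esub> y \<longleftrightarrow> (\<forall>x \<in> S. x \<sqsubseteq>\<^bsub>K\<^esub> z)"
          by (simp only: bspec[OF z(2) K.sup_closed[OF S]] K.sup_le_iff[OF S z(1)])
        also have "\<dots> \<longleftrightarrow> (\<forall>x \<in> S. f x \<sqsubseteq>\<^bsub>L\<^esub> y)"
          using z(2) S by blast
        finally show "f (\<Squnion>\<^bsub>K\<^esub> S) \<sqsubseteq>\<^bsub>L\<^esub> y \<longleftrightarrow> (\<forall>x \<in> f ` S. x \<sqsubseteq>\<^bsub>L\<^esub> y)"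
          by simp
      qed (use f S in blast, rule funcset_mem[OF f K.sup_closed[OF S]])
      then show "f (\<Squnion>\<^bsub>K\<^esub> S) = \<Squnion>\<^bsub>L\<^esub> (f ` S)" ..
    qed
  qed
qed

section \<open>Doubly based lattices and the concepts of their base contexts\<close>

locale doubly_based =
  fixes X :: "'a based_lattice"
  assumes doubly_based: "doubly_based_lattice X"

sublocale doubly_based \<subseteq> complete_lattice "lat X"
  using doubly_based by (simp add: doubly_based_lattice_def)

text \<open>For \<open>x\<close> in the carrier, \<open>below X x\<close> and
  \<open>above X x\<close> are the extent and the intent of the concept of
  \<open>base_context X\<close> that corresponds to \<open>x\<close>.\<close>

definition below :: "'a based_lattice \<Rightarrow> 'a \<Rightarrow> 'a set" where
  "below X x = {j \<in> jbase X. j \<sqsubseteq>\<^bsub>lat X\<^esub> x}"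

definition above :: "'a based_lattice \<Rightarrow> 'a \<Rightarrow> 'a set" where
  "above X x = {m \<in> mbase X. x \<sqsubseteq>\<^bsub>lat X\<^esub> m}"

lemma below_dual [simp]: "below (dual_based X) = above X"
  and above_dual [simp]: "above (dual_based X) = below X"
  by (simp_all add: below_def above_def fun_eq_iff)

lemma below_subset: "below X x \<subseteq> jbase X" and above_subset: "above X x \<subseteq> mbase X"
  by (auto simp: below_def above_def)

context doubly_based
begin

lemma jbase_subset: "jbase X \<subseteq> lcarrier X" and mbase_subset: "mbase X \<subseteq> lcarrier X"
  using doubly_based by (simp_all add: doubly_based_lattice_def)

lemma below_carrier: "below X x \<subseteq> lcarrier X" and above_carrier: "above X x \<subseteq> lcarrier X"
  using jbase_subset mbase_subset by (auto simp: below_def above_def)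

lemma dual: "doubly_based (dual_based X)"
  using doubly_based dual_complete_lattice
  by (simp add: doubly_based_def doubly_based_lattice_def)

text \<open>Density yields only some set of base elements with join \<open>x\<close>. It lies inside
  \<open>below X x\<close>, and everything there is below \<open>x\<close>, so both sets have the
  same upper bounds.\<close>

lemma sup_below: "x \<in> lcarrier X \<Longrightarrow> \<Squnion>\<^bsub>lat X\<^esub> (below X x) = x"
proof (rule sup_eqI)
  fix y assume x: "x \<in> lcarrier X" and y: "y \<in> lcarrier X"
  have "\<exists>S \<subseteq> jbase X. x = \<Squnion>\<^bsub>lat X\<^esub> S"
    using doubly_based x unfolding doubly_based_lattice_def by blast
  then obtain S where S: "S \<subseteq> jbase X" "x = \<Squnion>\<^bsub>lat X\<^esub> S"
    by blast
  have "j \<sqsubseteq>\<^bsub>lat X\<^esub> x" if "j \<in> S" for j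
    unfolding S(2) by (rule sup_upper) (use S(1) jbase_subset that in auto)
  then have S_below: "S \<subseteq> below X x"
    using S(1) by (auto simp: below_def)
  show "x \<sqsubseteq>\<^bsub>lat X\<^esub> y \<longleftrightarrow> (\<forall>j \<in> below X x. j \<sqsubseteq>\<^bsub>lat X\<^esub> y)"
  proof
    assume "x \<sqsubseteq>\<^bsub>lat X\<^esub> y"
    then show "\<forall>j \<in> below X x. j \<sqsubseteq>\<^bsub>lat X\<^esub> y"
      using x y jbase_subset le_trans unfolding below_def by blast
  next
    assume "\<forall>j \<in> below X x. j \<sqsubseteq>\<^bsub>lat X\<^esub> y"
    then have "\<Squnion>\<^bsub>lat X\<^esub> S \<sqsubseteq>\<^bsub>lat X\<^esub> y"
      using S_below S(1) y jbase_subset by (subst sup_le_iff) auto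
    then show "x \<sqsubseteq>\<^bsub>lat X\<^esub> y"
      by (simp only: S(2)[symmetric])
  qed
qed (simp_all add: below_carrier)

lemma le_iff_below:
  assumes "x \<in> lcarrier X" "y \<in> lcarrier X"
  shows "x \<sqsubseteq>\<^bsub>lat X\<^esub> y \<longleftrightarrow> below X x \<subseteq> below X y"
proof -
  have "x \<sqsubseteq>\<^bsub>lat X\<^esub> y \<longleftrightarrow> \<Squnion>\<^bsub>lat X\<^esub> (below X x) \<sqsubseteq>\<^bsub>lat X\<^esub> y"
    by (simp add: sup_below assms)
  also have "\<dots> \<longleftrightarrow> (\<forall>j \<in> below X x. j \<sqsubseteq>\<^bsub>lat X\<^esub> y)"
    by (rule sup_le_iff) (simp_all add: below_carrier assms)
  finally show ?thesis
    by (auto simp: below_def)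
qed

lemma inj_below: "inj_on (below X) (lcarrier X)"
  by (metis inj_onI sup_below)

interpretation dual: doubly_based "dual_based X" by (rule dual)

lemma inf_above: "x \<in> lcarrier X \<Longrightarrow> \<Sqinter>\<^bsub>lat X\<^esub> (above X x) = x"
  using dual.sup_below by simp

lemma inj_above: "inj_on (above X) (lcarrier X)"
  using dual.inj_below by simp

text \<open>A base element is a lower bound of \<open>B\<close> exactly when it lies below the meet
  of \<open>B\<close>, so derivation in the context is the meet in the lattice, seen through the
  join-base.\<close>

lemma down_base: "B \<subseteq> mbase X \<Longrightarrow> down (base_context X) B = below X (\<Sqinter>\<^bsub>lat X\<^esub> B)"
  using inf_ge_iff[of B] jbase_subset mbase_subset
  by (force simp: down_def base_context_def below_def)

lemma up_base: "A \<subseteq> jbase X \<Longrightarrow> up (base_context X) A = above X (\<Squnion>\<^bsub>lat X\<^esub> A)"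
  using sup_le_iff[of A] jbase_subset mbase_subset
  by (force simp: up_def base_context_def above_def)

lemma down_above: "x \<in> lcarrier X \<Longrightarrow> down (base_context X) (above X x) = below X x"
  by (simp add: down_base above_subset inf_above)

lemma up_below: "x \<in> lcarrier X \<Longrightarrow> up (base_context X) (below X x) = above X x"
  by (simp add: up_base below_subset sup_below)

text \<open>Derivations of sets of attributes are traces of meets. Conversely each \<open>x\<close>
  is the meet of \<open>above X x\<close>, so its trace is a derivation; this direction uses that
  the meet-base is dense.\<close>

lemma extents_base: "extents (base_context X) = below X ` lcarrier X"
proof (intro equalityI subsetI)
  fix A assume "A \<in> extents (base_context X)"
  then show "A \<in> below X ` lcarrier X"
    using mbase_subset by (auto simp: extents_eq down_base)
next
  fix A assume "A \<in> below X ` lcarrier X"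
  then show "A \<in> extents (base_context X)"
    unfolding extents_eq using down_above above_subset[of X] by fastforce
qed

lemma concepts_base: "concepts (base_context X) = (\<lambda>x. (below X x, above X x)) ` lcarrier X"
  by (auto simp: concepts_eq extents_base up_below image_iff)

lemma up_singleton: "j \<in> jbase X \<Longrightarrow> up (base_context X) {j} = above X j"
  by (auto simp: up_def base_context_def above_def)

lemma down_singleton: "m \<in> mbase X \<Longrightarrow> down (base_context X) {m} = below X m"
  by (auto simp: down_def base_context_def below_def)

text \<open>The intent of the object concept of \<open>j\<close> is \<open>above X j\<close>, from
  which \<open>j\<close> is recovered as a meet; dually for attributes. Each injectivity thus comes
  from density of the opposite base.\<close>

lemma purified_base: "purified_context (base_context X)"
proof -
  have "inj_on (gamma (base_context X)) (jbase X)"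
    using inj_on_subset[OF inj_above jbase_subset]
    by (auto simp: inj_on_def gamma_def up_singleton)
  moreover have "inj_on (mu (base_context X)) (mbase X)"
    using inj_on_subset[OF inj_below mbase_subset]
    by (auto simp: inj_on_def mu_def down_singleton)
  ultimately show ?thesis
    by (auto simp: purified_context_def base_context_def)
qed

end

section \<open>Morphisms of doubly based lattices\<close>

text \<open>The formula is forced: a join-preserving extension must respect the representation of
  \<open>x\<close> as the join of \<open>below X x\<close>.\<close>

definition join_extension ::
  "'a based_lattice \<Rightarrow> 'b based_lattice \<Rightarrow> ('a \<Rightarrow> 'b) \<Rightarrow> 'a \<Rightarrow> 'b" where
  "join_extension X Y \<alpha> = (\<lambda>x \<in> lcarrier X. \<Squnion>\<^bsub>lat Y\<^esub> (\<alpha> ` below X x))"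

lemma restrict_eq_on: "f x = g x" if "restrict f A = restrict g A" "x \<in> A"
  using that by (metis restrict_apply')

locale doubly_based_pair = X: doubly_based X + Y: doubly_based Y
  for X :: "'a based_lattice" and Y :: "'b based_lattice"
begin

lemma dual_pair: "doubly_based_pair (dual_based X) (dual_based Y)"
  using X.dual Y.dual by (rule doubly_based_pair.intro)

lemma join_preserving_eq:
  assumes \<phi>: "preserves_joins (lat X) (lat Y) \<phi>" and x: "x \<in> lcarrier X"
  shows "\<phi> x = \<Squnion>\<^bsub>lat Y\<^esub> (\<phi> ` below X x)"
proof -
  have "\<phi> (\<Squnion>\<^bsub>lat X\<^esub> (below X x)) = \<Squnion>\<^bsub>lat Y\<^esub> (\<phi> ` below X x)"
    using \<phi> X.below_carrier by (simp add: preserves_joins_def)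
  then show ?thesis by (simp add: X.sup_below x)
qed

lemma join_preserving_eqI:
  assumes "preserves_joins (lat X) (lat Y) \<phi>" "preserves_joins (lat X) (lat Y) \<psi>"
    and "\<phi> \<in> extensional (lcarrier X)" "\<psi> \<in> extensional (lcarrier X)"
    and eq: "\<And>j. j \<in> jbase X \<Longrightarrow> \<phi> j = \<psi> j"
  shows "\<phi> = \<psi>"
proof (rule extensionalityI[OF assms(3,4)])
  fix x assume x: "x \<in> lcarrier X"
  have "\<phi> ` below X x = \<psi> ` below X x"
    by (rule image_cong) (use eq below_subset[of X x] in auto)
  then show "\<phi> x = \<psi> x"
    by (simp add: join_preserving_eq[OF assms(1) x] join_preserving_eq[OF assms(2) x])
qed

text \<open>With \<open>z\<close> the value of the upper adjoint of \<open>\<phi>\<close> at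
  \<open>y\<close>, an element is sent below \<open>y\<close> iff it lies below \<open>z\<close>. As
  \<open>\<phi>\<close> maps base to base, intersecting with the bases makes the preimage of
  \<open>below Y y\<close> equal to \<open>below X z\<close>.\<close>

lemma preimage_below:
  assumes \<phi>: "\<phi> \<in> lcarrier X \<rightarrow> lcarrier Y" "preserves_joins (lat X) (lat Y) \<phi>"
      "\<phi> ` jbase X \<subseteq> jbase Y"
    and E: "E \<in> extents (base_context Y)"
  shows "restrict \<phi> (jbase X) -` E \<inter> jbase X \<in> extents (base_context X)"
proof -
  obtain y where y: "y \<in> lcarrier Y" "E = below Y y"
    using E by (auto simp: Y.extents_base)
  obtain z where z: "z \<in> lcarrier X" "\<forall>x \<in> lcarrier X. \<phi> x \<sqsubseteq>\<^bsub>lat Y\<^esub> y \<longleftrightarrow> x \<sqsubseteq>\<^bsub>lat X\<^esub> z"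
    using bspec[OF iffD1[OF preserves_joins_adjoint[OF X.complete_lattice_axioms
      Y.complete_lattice_axioms \<phi>(1)] \<phi>(2)] y(1)] by (rule bexE)
  have "restrict \<phi> (jbase X) -` E \<inter> jbase X = below X z"
    using z(2) \<phi>(3) X.jbase_subset by (auto simp: below_def y(2) subset_iff)
  with z(1) show ?thesis by (simp add: X.extents_base)
qed

section \<open>Extending a continuous map of join-bases to a join-preserving map\<close>

context
  fixes \<alpha> :: "'a \<Rightarrow> 'b"
  assumes \<alpha>: "\<alpha> ` jbase X \<subseteq> jbase Y"
    and preimage: "\<And>E. E \<in> extents (base_context Y) \<Longrightarrow>
      \<alpha> -` E \<inter> jbase X \<in> extents (base_context X)"
begin

lemma image_below_carrier: "\<alpha> ` below X x \<subseteq> lcarrier Y"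
  using \<alpha> below_subset[of X x] Y.jbase_subset by blast

lemma join_extension_closed: "join_extension X Y \<alpha> \<in> lcarrier X \<rightarrow>\<^sub>E lcarrier Y"
  by (simp add: join_extension_def Y.sup_closed image_below_carrier)

text \<open>The converse of \<open>preimage_below\<close>: the preimage of \<open>below Y y\<close>
  is an extent, hence of the form \<open>below X z\<close>, and this \<open>z\<close> serves as the
  value of the adjoint. The join of the images of \<open>below X x\<close> lies below
  \<open>y\<close> iff \<open>below X x\<close> is contained in that preimage.\<close>

lemma join_extension_adjoint:
  assumes y: "y \<in> lcarrier Y"
  shows "\<exists>z \<in> lcarrier X. \<forall>x \<in> lcarrier X.
    join_extension X Y \<alpha> x \<sqsubseteq>\<^bsub>lat Y\<^esub> y \<longleftrightarrow> x \<sqsubseteq>\<^bsub>lat X\<^esub> z"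
proof -
  have "\<alpha> -` below Y y \<inter> jbase X \<in> extents (base_context X)"
    using y by (intro preimage) (simp add: Y.extents_base)
  then obtain z where z: "z \<in> lcarrier X" "\<alpha> -` below Y y \<inter> jbase X = below X z"
    by (auto simp: X.extents_base)
  have "join_extension X Y \<alpha> x \<sqsubseteq>\<^bsub>lat Y\<^esub> y \<longleftrightarrow> x \<sqsubseteq>\<^bsub>lat X\<^esub> z" if x: "x \<in> lcarrier X" for x
  proof -
    have "join_extension X Y \<alpha> x \<sqsubseteq>\<^bsub>lat Y\<^esub> y \<longleftrightarrow> (\<forall>j \<in> below X x. \<alpha> j \<sqsubseteq>\<^bsub>lat Y\<^esub> y)"
      using x by (simp add: join_extension_def Y.sup_le_iff[OF image_below_carrier y])
    also have "\<dots> \<longleftrightarrow> below X x \<subseteq> \<alpha> -` below Y y \<inter> jbase X"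
      using \<alpha> below_subset[of X x] by (auto simp: below_def)
    also have "\<dots> \<longleftrightarrow> x \<sqsubseteq>\<^bsub>lat X\<^esub> z"
      by (simp only: z(2) X.le_iff_below[OF x z(1)])
    finally show ?thesis .
  qed
  with z(1) show ?thesis by blast
qed

lemma join_extension_preserves_joins:
  "preserves_joins (lat X) (lat Y) (join_extension X Y \<alpha>)"
proof -
  have "join_extension X Y \<alpha> \<in> lcarrier X \<rightarrow> lcarrier Y"
    using join_extension_closed by (simp add: PiE_def)
  then show ?thesis
    using join_extension_adjoint
    by (simp only: preserves_joins_adjoint[OF X.complete_lattice_axioms Y.complete_lattice_axioms])
      blast
qed

text \<open>Continuity makes \<open>\<alpha>\<close> monotone on the base, so
  \<open>\<alpha> j\<close> is the greatest element of the image of \<open>below X j\<close> and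
  therefore its join.\<close>

lemma join_extension_base:
  assumes j: "j \<in> jbase X"
  shows "join_extension X Y \<alpha> j = \<alpha> j"
proof -
  have jc: "j \<in> lcarrier X" and \<alpha>j: "\<alpha> j \<in> lcarrier Y"
    using j X.jbase_subset \<alpha> Y.jbase_subset by auto
  have "\<Squnion>\<^bsub>lat Y\<^esub> (\<alpha> ` below X j) = \<alpha> j"
  proof (rule Y.sup_eqI[OF image_below_carrier \<alpha>j])
    fix y assume y: "y \<in> lcarrier Y"
    \<comment> \<open>Monotonicity in the form used here: the base elements sent below
      \<open>y\<close> are those below a single \<open>z\<close>, hence include everything in
      \<open>below X j\<close> as soon as they include \<open>j\<close>.\<close>
    have "\<alpha> -` below Y y \<inter> jbase X \<in> extents (base_context X)"
      using y by (intro preimage) (simp add: Y.extents_base)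
    then obtain z where z: "z \<in> lcarrier X" "\<alpha> -` below Y y \<inter> jbase X = below X z"
      by (auto simp: X.extents_base)
    have iff: "\<alpha> i \<sqsubseteq>\<^bsub>lat Y\<^esub> y \<longleftrightarrow> i \<sqsubseteq>\<^bsub>lat X\<^esub> z" if "i \<in> jbase X" for i
      using z(2) that \<alpha> by (auto simp: below_def)
    have le: "i \<sqsubseteq>\<^bsub>lat X\<^esub> z" if "j \<sqsubseteq>\<^bsub>lat X\<^esub> z" "i \<in> below X j" for i
      using X.le_trans[of i j z] that jc z(1) X.jbase_subset by (auto simp: below_def)
    show "\<alpha> j \<sqsubseteq>\<^bsub>lat Y\<^esub> y \<longleftrightarrow> (\<forall>x \<in> \<alpha> ` below X j. x \<sqsubseteq>\<^bsub>lat Y\<^esub> y)"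
    proof
      assume "\<alpha> j \<sqsubseteq>\<^bsub>lat Y\<^esub> y"
      then show "\<forall>x \<in> \<alpha> ` below X j. x \<sqsubseteq>\<^bsub>lat Y\<^esub> y"
        using iff[OF j] iff le below_subset[of X j] by blast
    next
      assume "\<forall>x \<in> \<alpha> ` below X j. x \<sqsubseteq>\<^bsub>lat Y\<^esub> y"
      then show "\<alpha> j \<sqsubseteq>\<^bsub>lat Y\<^esub> y"
        using j jc by (auto simp: below_def)
    qed
  qed
  then show ?thesis by (simp add: join_extension_def jc)
qed

end

lemma base_morphism:
  assumes "(\<phi>, \<psi>) \<in> CLjm_morphisms X Y"
  shows "(restrict \<phi> (jbase X), restrict \<psi> (mbase X)) \<in>
      mapping_pairs (base_context X) (base_context Y)"
    and "separately_continuous (base_context X) (base_context Y)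
      (restrict \<phi> (jbase X), restrict \<psi> (mbase X))"
proof -
  from assms have \<phi>: "\<phi> \<in> lcarrier X \<rightarrow> lcarrier Y" "preserves_joins (lat X) (lat Y) \<phi>"
      "\<phi> ` jbase X \<subseteq> jbase Y"
    and \<psi>: "\<psi> \<in> lcarrier X \<rightarrow> lcarrier Y" "preserves_meets (lat X) (lat Y) \<psi>"
      "\<psi> ` mbase X \<subseteq> mbase Y"
    by (auto simp: CLjm_morphisms_def)
  show "(restrict \<phi> (jbase X), restrict \<psi> (mbase X)) \<in>
      mapping_pairs (base_context X) (base_context Y)"
    using \<phi>(3) \<psi>(3) by (auto simp: mapping_pairs_def)
  show "separately_continuous (base_context X) (base_context Y)
      (restrict \<phi> (jbase X), restrict \<psi> (mbase X))"
    \<comment> \<open>The half about intents is the same lemma for the reversed orders, where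
      \<open>\<psi>\<close> preserves joins.\<close>
    using preimage_below[OF \<phi>] doubly_based_pair.preimage_below[OF dual_pair, of \<psi>] \<psi>
    by (simp add: separately_continuous_def base_context_dual)
qed

lemma base_morphism_faithful:
  assumes "(\<phi>, \<psi>) \<in> CLjm_morphisms X Y" "(\<phi>', \<psi>') \<in> CLjm_morphisms X Y"
    and "restrict \<phi> (jbase X) = restrict \<phi>' (jbase X)"
    and "restrict \<psi> (mbase X) = restrict \<psi>' (mbase X)"
  shows "\<phi> = \<phi>'" and "\<psi> = \<psi>'"
proof -
  from assms(1,2) have joins: "preserves_joins (lat X) (lat Y) \<phi>" "preserves_joins (lat X) (lat Y) \<phi>'"
    and meets: "preserves_meets (lat X) (lat Y) \<psi>" "preserves_meets (lat X) (lat Y) \<psi>'"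
    and ext: "\<phi> \<in> extensional (lcarrier X)" "\<phi>' \<in> extensional (lcarrier X)"
      "\<psi> \<in> extensional (lcarrier X)" "\<psi>' \<in> extensional (lcarrier X)"
    by (simp_all add: CLjm_morphisms_def PiE_def)
  show "\<phi> = \<phi>'"
    using joins ext(1,2) restrict_eq_on[OF assms(3)] by (rule join_preserving_eqI)
  show "\<psi> = \<psi>'"
    by (rule doubly_based_pair.join_preserving_eqI[OF dual_pair])
      (use meets ext(3,4) restrict_eq_on[OF assms(4)] in simp_all)
qed

lemma base_morphism_full:
  assumes "(\<alpha>, \<beta>) \<in> mapping_pairs (base_context X) (base_context Y)"
    and "separately_continuous (base_context X) (base_context Y) (\<alpha>, \<beta>)"
  obtains \<phi> \<psi> where "(\<phi>, \<psi>) \<in> CLjm_morphisms X Y"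
    and "restrict \<phi> (jbase X) = \<alpha>" and "restrict \<psi> (mbase X) = \<beta>"
proof
  \<comment> \<open>Unfolding the dual, \<open>?\<psi>\<close> sends \<open>x\<close> to the meet of
    the images under \<open>\<beta>\<close> of \<open>above X x\<close>.\<close>
  let ?\<phi> = "join_extension X Y \<alpha>" and ?\<psi> = "join_extension (dual_based X) (dual_based Y) \<beta>"
  have \<alpha>: "\<alpha> \<in> jbase X \<rightarrow>\<^sub>E jbase Y" and \<beta>: "\<beta> \<in> mbase X \<rightarrow>\<^sub>E mbase Y"
    using assms(1) by (simp_all add: mapping_pairs_def)
  have \<alpha>_img: "\<alpha> ` jbase X \<subseteq> jbase Y" and \<beta>_img: "\<beta> ` mbase X \<subseteq> mbase Y"
    using \<alpha> \<beta> by auto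
  have \<alpha>_pre: "\<And>E. E \<in> extents (base_context Y) \<Longrightarrow> \<alpha> -` E \<inter> jbase X \<in> extents (base_context X)"
    and \<beta>_pre: "\<And>E. E \<in> intents (base_context Y) \<Longrightarrow> \<beta> -` E \<inter> mbase X \<in> intents (base_context X)"
    using assms(2) by (simp_all add: separately_continuous_def)
  have \<beta>_dual: "\<beta> ` jbase (dual_based X) \<subseteq> jbase (dual_based Y)"
      "\<And>E. E \<in> extents (base_context (dual_based Y)) \<Longrightarrow>
        \<beta> -` E \<inter> jbase (dual_based X) \<in> extents (base_context (dual_based X))"
    using \<beta>_img \<beta>_pre by (simp_all add: base_context_dual)
  note \<phi> = join_extension_closed[OF \<alpha>_img \<alpha>_pre] join_extension_preserves_joins[OF \<alpha>_img \<alpha>_pre]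
    join_extension_base[OF \<alpha>_img \<alpha>_pre]
  note \<psi> = doubly_based_pair.join_extension_closed[OF dual_pair \<beta>_dual]
    doubly_based_pair.join_extension_preserves_joins[OF dual_pair \<beta>_dual]
    doubly_based_pair.join_extension_base[OF dual_pair \<beta>_dual]
  show "(?\<phi>, ?\<psi>) \<in> CLjm_morphisms X Y"
    using \<phi> \<psi> \<alpha>_img \<beta>_img by (simp add: CLjm_morphisms_def)
  show "restrict ?\<phi> (jbase X) = \<alpha>"
    using \<alpha> \<phi>(3) by (intro extensionalityI[of _ "jbase X"]) (auto simp: PiE_def)
  show "restrict ?\<psi> (mbase X) = \<beta>"
    using \<beta> \<psi>(3) by (intro extensionalityI[of _ "mbase X"]) (auto simp: PiE_def)
qed

text \<open>Evaluates the two components in the definition of \<open>conceptual\<close> at the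
  concept belonging to \<open>x\<close>. Upper bounds of the image of \<open>below X x\<close> are
  upper bounds of its join, which is \<open>\<phi> x\<close>; the second component is dual.\<close>

lemma image_base:
  assumes "(\<phi>, \<psi>) \<in> CLjm_morphisms X Y" and x: "x \<in> lcarrier X"
  shows "up (base_context Y) (restrict \<phi> (jbase X) ` below X x) = above Y (\<phi> x)"
    and "down (base_context Y) (restrict \<psi> (mbase X) ` above X x) = below Y (\<psi> x)"
proof -
  from assms have \<phi>: "preserves_joins (lat X) (lat Y) \<phi>" "\<phi> ` jbase X \<subseteq> jbase Y"
    and \<psi>: "preserves_meets (lat X) (lat Y) \<psi>" "\<psi> ` mbase X \<subseteq> mbase Y"
    by (auto simp: CLjm_morphisms_def)
  have "restrict \<phi> (jbase X) ` below X x = \<phi> ` below X x"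
    by (rule image_cong) (use below_subset[of X x] in auto)
  moreover have "\<phi> ` below X x \<subseteq> jbase Y"
    using image_mono[OF below_subset] \<phi>(2) by (rule subset_trans)
  ultimately show "up (base_context Y) (restrict \<phi> (jbase X) ` below X x) = above Y (\<phi> x)"
    by (simp add: Y.up_base join_preserving_eq[OF \<phi>(1) x])
  have "restrict \<psi> (mbase X) ` above X x = \<psi> ` above X x"
    by (rule image_cong) (use above_subset[of X x] in auto)
  moreover have "\<psi> ` above X x \<subseteq> mbase Y"
    using image_mono[OF above_subset] \<psi>(2) by (rule subset_trans)
  moreover have "\<psi> x = \<Sqinter>\<^bsub>lat Y\<^esub> (\<psi> ` above X x)"
    using doubly_based_pair.join_preserving_eq[OF dual_pair, of \<psi> x] \<psi>(1) x by simp
  ultimately show "down (base_context Y) (restrict \<psi> (mbase X) ` above X x) = below Y (\<psi> x)"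
    by (simp add: Y.down_base)
qed

text \<open>The extent of \<open>\<psi> x\<close> and the intent of \<open>\<phi> x\<close> form a
  concept iff both belong to one element \<open>y\<close>. Since an element is determined by its
  extent, and also by its intent, this means that \<open>\<psi> x\<close> and
  \<open>\<phi> x\<close> are equal.\<close>

lemma conceptual_base_iff:
  assumes "(\<phi>, \<psi>) \<in> CLjm_morphisms X Y"
  shows "conceptual (base_context X) (base_context Y)
      (restrict \<phi> (jbase X), restrict \<psi> (mbase X)) \<longleftrightarrow> \<phi> = \<psi>"
proof -
  have cl: "\<phi> x \<in> lcarrier Y" "\<psi> x \<in> lcarrier Y" if "x \<in> lcarrier X" for x
    using assms that by (auto simp: CLjm_morphisms_def)
  have "conceptual (base_context X) (base_context Y)
      (restrict \<phi> (jbase X), restrict \<psi> (mbase X)) \<longleftrightarrow>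
    (\<forall>x \<in> lcarrier X. (below Y (\<psi> x), above Y (\<phi> x)) \<in> concepts (base_context Y))"
    using base_morphism(2)[OF assms]
    by (simp only: conceptual_def case_prod_conv X.concepts_base ball_simps image_base[OF assms]
        simp_thms cong: ball_cong)
  also have "\<dots> \<longleftrightarrow> (\<forall>x \<in> lcarrier X. \<phi> x = \<psi> x)"
  proof (rule ball_cong[OF refl])
    fix x assume x: "x \<in> lcarrier X"
    show "(below Y (\<psi> x), above Y (\<phi> x)) \<in> concepts (base_context Y) \<longleftrightarrow> \<phi> x = \<psi> x"
    proof
      assume "(below Y (\<psi> x), above Y (\<phi> x)) \<in> concepts (base_context Y)"
      then obtain y where "y \<in> lcarrier Y" "below Y (\<psi> x) = below Y y" "above Y (\<phi> x) = above Y y"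
        unfolding Y.concepts_base by blast
      then show "\<phi> x = \<psi> x"
        using cl[OF x] inj_onD[OF Y.inj_below] inj_onD[OF Y.inj_above] by metis
    next
      assume "\<phi> x = \<psi> x"
      with cl[OF x] show "(below Y (\<psi> x), above Y (\<phi> x)) \<in> concepts (base_context Y)"
        unfolding Y.concepts_base by simp
    qed
  qed
  also have "\<dots> \<longleftrightarrow> \<phi> = \<psi>"
  proof
    assume "\<forall>x \<in> lcarrier X. \<phi> x = \<psi> x"
    then show "\<phi> = \<psi>"
      using assms by (intro extensionalityI[of _ "lcarrier X"]) (auto simp: CLjm_morphisms_def PiE_def)
  qed simp
  finally show ?thesis .
qed

end

section \<open>Concept lattices\<close>

lemma concepts_iff:
  "(A, B) \<in> concepts K \<longleftrightarrow> A \<subseteq> objs K \<and> B \<subseteq> attrs K \<and> down K B = A \<and> up K A = B"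
  by (auto simp: concepts_def)

lemma conceptD:
  assumes "c \<in> concepts K"
  shows "fst c \<subseteq> objs K" "snd c \<subseteq> attrs K" "down K (snd c) = fst c" "up K (fst c) = snd c"
  using assms concepts_iff[of "fst c" "snd c" K] by simp_all

lemma object_concept: "A \<subseteq> objs K \<Longrightarrow> (down K (up K A), up K A) \<in> concepts K"
  and attribute_concept: "B \<subseteq> attrs K \<Longrightarrow> (down K B, up K (down K B)) \<in> concepts K"
  by (simp_all add: concepts_iff up_down_up down_up_down up_subset down_subset)

text \<open>The universal property of the concept generated by a set of objects; it is what makes
  that concept a join.\<close>

lemma object_concept_le_iff:
  assumes "A \<subseteq> objs K" "d \<in> concepts K"
  shows "down K (up K A) \<subseteq> fst d \<longleftrightarrow> A \<subseteq> fst d"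
proof -
  have "down K (up K A) \<subseteq> down K (snd d) \<longleftrightarrow> snd d \<subseteq> up K A"
    using conceptD(2)[OF assms(2)] assms(1)
    by (simp add: subset_down_iff down_subset up_down_up)
  also have "\<dots> \<longleftrightarrow> A \<subseteq> down K (snd d)"
    using conceptD(2)[OF assms(2)] assms(1) by (simp add: subset_down_iff)
  finally show ?thesis by (simp add: conceptD[OF assms(2)])
qed

lemma le_attribute_concept_iff:
  "B \<subseteq> attrs K \<Longrightarrow> d \<in> concepts K \<Longrightarrow> fst d \<subseteq> down K B \<longleftrightarrow> B \<subseteq> snd d"
  by (simp add: subset_down_iff conceptD)

lemma concept_le_iff:
  "c \<in> concepts K \<Longrightarrow> d \<in> concepts K \<Longrightarrow> fst c \<subseteq> fst d \<longleftrightarrow> snd d \<subseteq> snd c"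
  using le_attribute_concept_iff[of "snd d" K c] by (simp add: conceptD)

lemma concept_eqI: "(A, B) \<in> concepts K \<Longrightarrow> (A, B') \<in> concepts K \<Longrightarrow> B = B'"
  by (simp add: concepts_iff)

lemma gamma_concept: "j \<in> objs K \<Longrightarrow> gamma K j \<in> concepts K"
  and mu_concept: "m \<in> attrs K \<Longrightarrow> mu K m \<in> concepts K"
  by (simp_all add: gamma_def mu_def object_concept attribute_concept)

lemma gamma_image: "A \<subseteq> objs K \<Longrightarrow> gamma K ` A \<subseteq> concepts K"
  and mu_image: "B \<subseteq> attrs K \<Longrightarrow> mu K ` B \<subseteq> concepts K"
  by (auto simp: subset_iff gamma_concept mu_concept simp del: split_paired_All)

lemma gamma_le_iff: "j \<in> objs K \<Longrightarrow> d \<in> concepts K \<Longrightarrow> fst (gamma K j) \<subseteq> fst d \<longleftrightarrow> j \<in> fst d"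
  by (simp add: gamma_def object_concept_le_iff)

lemma le_mu_iff: "m \<in> attrs K \<Longrightarrow> d \<in> concepts K \<Longrightarrow> fst d \<subseteq> fst (mu K m) \<longleftrightarrow> m \<in> snd d"
  by (simp add: mu_def le_attribute_concept_iff)

section \<open>The concept lattice of one context, transported along an injective coding\<close>

locale encoded_context =
  fixes K :: "('a, 'b) fcontext" and code :: "'a set \<times> 'b set \<Rightarrow> 'u"
  assumes inj_code: "inj_on code (concepts K)"
begin

abbreviation BK :: "'u based_lattice" where
  "BK \<equiv> rename_lattice code (augmented_lattice K)"

lemma BK_simps [simp]:
  "lcarrier BK = code ` concepts K"
  "jbase BK = code ` gamma K ` objs K"
  "mbase BK = code ` mu K ` attrs K"
  by (simp_all add: rename_lattice_def augmented_lattice_def concept_lattice_def)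

lemma BK_le [simp]:
  "c \<in> concepts K \<Longrightarrow> d \<in> concepts K \<Longrightarrow> code c \<sqsubseteq>\<^bsub>lat BK\<^esub> code d \<longleftrightarrow> fst c \<subseteq> fst d"
  by (simp add: rename_lattice_def augmented_lattice_def concept_lattice_def inj_code)

lemma partial_order_BK: "partial_order (lat BK)"
proof -
  have eq: "eq (lat BK) = (=)"
    by (simp add: rename_lattice_def)
  show ?thesis
    \<comment> \<open>Antisymmetry holds because the extent determines the concept and
      \<open>code\<close> is injective on concepts.\<close>
    by unfold_locales (auto simp: eq inj_on_eq_iff[OF inj_code] dest: concept_eqI)
qed

lemma complete_lattice_BK: "complete_lattice (lat BK)"
proof (rule complete_latticeI_sup_inf[OF partial_order_BK])
  fix S assume "S \<subseteq> lcarrier BK"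
  then obtain Q where Q: "Q \<subseteq> concepts K" "S = code ` Q"
    by (auto simp: subset_image_iff)
  let ?A = "\<Union>(fst ` Q)" and ?B = "\<Union>(snd ` Q)"
  have A: "?A \<subseteq> objs K" and B: "?B \<subseteq> attrs K"
    using Q(1) conceptD(1,2) by blast+
  \<comment> \<open>The join is generated by the union of the extents, the meet by the union of the
    intents.\<close>
  let ?s = "(down K (up K ?A), up K ?A)" and ?i = "(down K ?B, up K (down K ?B))"
  have s: "?s \<in> concepts K" and i: "?i \<in> concepts K"
    using A B by (simp_all add: object_concept attribute_concept)
  have "code ?s \<sqsubseteq>\<^bsub>lat BK\<^esub> code d \<longleftrightarrow> (\<forall>c \<in> Q. code c \<sqsubseteq>\<^bsub>lat BK\<^esub> code d)" if d: "d \<in> concepts K" for d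
  proof -
    have "code ?s \<sqsubseteq>\<^bsub>lat BK\<^esub> code d \<longleftrightarrow> ?A \<subseteq> fst d"
      using d s by (simp add: object_concept_le_iff[OF A d])
    also have "\<dots> \<longleftrightarrow> (\<forall>c \<in> Q. fst c \<subseteq> fst d)"
      by blast
    also have "\<dots> \<longleftrightarrow> (\<forall>c \<in> Q. code c \<sqsubseteq>\<^bsub>lat BK\<^esub> code d)"
      using BK_le[OF _ d] Q(1) by blast
    finally show ?thesis .
  qed
  then show "\<exists>s \<in> lcarrier BK. \<forall>y \<in> lcarrier BK. s \<sqsubseteq>\<^bsub>lat BK\<^esub> y \<longleftrightarrow> (\<forall>x \<in> S. x \<sqsubseteq>\<^bsub>lat BK\<^esub> y)"
    using s Q by (intro bexI[of _ "code ?s"]) auto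
  have "code d \<sqsubseteq>\<^bsub>lat BK\<^esub> code ?i \<longleftrightarrow> (\<forall>c \<in> Q. code d \<sqsubseteq>\<^bsub>lat BK\<^esub> code c)" if d: "d \<in> concepts K" for d
  proof -
    have "code d \<sqsubseteq>\<^bsub>lat BK\<^esub> code ?i \<longleftrightarrow> ?B \<subseteq> snd d"
      using d i by (simp add: le_attribute_concept_iff[OF B d])
    also have "\<dots> \<longleftrightarrow> (\<forall>c \<in> Q. fst d \<subseteq> fst c)"
      using concept_le_iff[OF d] Q(1) by blast
    also have "\<dots> \<longleftrightarrow> (\<forall>c \<in> Q. code d \<sqsubseteq>\<^bsub>lat BK\<^esub> code c)"
      using BK_le[OF d] Q(1) by blast
    finally show ?thesis .
  qed
  then show "\<exists>s \<in> lcarrier BK. \<forall>y \<in> lcarrier BK. y \<sqsubseteq>\<^bsub>lat BK\<^esub> s \<longleftrightarrow> (\<forall>x \<in> S. y \<sqsubseteq>\<^bsub>lat BK\<^esub> x)"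
    using i Q by (intro bexI[of _ "code ?i"]) auto
qed

text \<open>A concept lies above all \<open>gamma K j\<close> with \<open>j\<close> in
  \<open>A\<close> iff its extent contains \<open>A\<close>, that is, iff it lies above the concept
  generated by \<open>A\<close>. Taking \<open>A\<close> to be an extent gives join-density of the
  object concepts.\<close>

lemma sup_gamma:
  assumes "A \<subseteq> objs K"
  shows "\<Squnion>\<^bsub>lat BK\<^esub> (code ` gamma K ` A) = code (down K (up K A), up K A)"
proof (rule complete_lattice.sup_eqI[OF complete_lattice_BK])
  show "code ` gamma K ` A \<subseteq> lcarrier BK" "code (down K (up K A), up K A) \<in> lcarrier BK"
    using image_mono[OF gamma_image[OF assms]] object_concept[OF assms] by simp_all
  fix y assume "y \<in> lcarrier BK"
  then obtain d where d: "d \<in> concepts K" "y = code d" by auto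
  have "code (down K (up K A), up K A) \<sqsubseteq>\<^bsub>lat BK\<^esub> y \<longleftrightarrow> A \<subseteq> fst d"
    using d assms by (simp add: object_concept object_concept_le_iff)
  also have "\<dots> \<longleftrightarrow> (\<forall>j \<in> A. code (gamma K j) \<sqsubseteq>\<^bsub>lat BK\<^esub> y)"
    using assms gamma_concept[THEN BK_le[OF _ d(1)]] gamma_le_iff[OF _ d(1)] d(2) by blast
  finally show "code (down K (up K A), up K A) \<sqsubseteq>\<^bsub>lat BK\<^esub> y \<longleftrightarrow>
      (\<forall>x \<in> code ` gamma K ` A. x \<sqsubseteq>\<^bsub>lat BK\<^esub> y)"
    by simp
qed

lemma inf_mu:
  assumes "B \<subseteq> attrs K"
  shows "\<Sqinter>\<^bsub>lat BK\<^esub> (code ` mu K ` B) = code (down K B, up K (down K B))"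
proof (rule complete_lattice.inf_eqI[OF complete_lattice_BK])
  show "code ` mu K ` B \<subseteq> lcarrier BK" "code (down K B, up K (down K B)) \<in> lcarrier BK"
    using image_mono[OF mu_image[OF assms]] attribute_concept[OF assms] by simp_all
  fix y assume "y \<in> lcarrier BK"
  then obtain d where d: "d \<in> concepts K" "y = code d" by auto
  have "y \<sqsubseteq>\<^bsub>lat BK\<^esub> code (down K B, up K (down K B)) \<longleftrightarrow> B \<subseteq> snd d"
    using d assms by (simp add: attribute_concept le_attribute_concept_iff)
  also have "\<dots> \<longleftrightarrow> (\<forall>m \<in> B. y \<sqsubseteq>\<^bsub>lat BK\<^esub> code (mu K m))"
    using assms mu_concept[THEN BK_le[OF d(1)]] le_mu_iff[OF _ d(1)] d(2) by blast
  finally show "y \<sqsubseteq>\<^bsub>lat BK\<^esub> code (down K B, up K (down K B)) \<longleftrightarrow>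
      (\<forall>x \<in> code ` mu K ` B. y \<sqsubseteq>\<^bsub>lat BK\<^esub> x)"
    by simp
qed

lemma concept_sup_gamma: "c \<in> concepts K \<Longrightarrow> code c = \<Squnion>\<^bsub>lat BK\<^esub> (code ` gamma K ` fst c)"
  using sup_gamma[of "fst c"] by (simp add: conceptD)

lemma concept_inf_mu: "c \<in> concepts K \<Longrightarrow> code c = \<Sqinter>\<^bsub>lat BK\<^esub> (code ` mu K ` snd c)"
  using inf_mu[of "snd c"] by (simp add: conceptD)

lemma doubly_based_BK: "doubly_based_lattice BK"
  unfolding doubly_based_lattice_def
proof (intro conjI ballI complete_lattice_BK)
  show "jbase BK \<subseteq> lcarrier BK" "mbase BK \<subseteq> lcarrier BK"
    using image_mono[OF gamma_image[OF subset_refl]] image_mono[OF mu_image[OF subset_refl]]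
    by simp_all
  fix x assume "x \<in> lcarrier BK"
  then obtain c where c: "c \<in> concepts K" "x = code c" by auto
  have "code ` gamma K ` fst c \<subseteq> jbase BK" "code ` mu K ` snd c \<subseteq> mbase BK"
    using conceptD(1,2)[OF c(1)] by auto
  then show "\<exists>S \<subseteq> jbase BK. x = \<Squnion>\<^bsub>lat BK\<^esub> S" "\<exists>S \<subseteq> mbase BK. x = \<Sqinter>\<^bsub>lat BK\<^esub> S"
    using concept_sup_gamma[OF c(1)] concept_inf_mu[OF c(1)] c(2) by blast+
qed

text \<open>The object concept of \<open>j\<close> lies below a concept iff \<open>j\<close> is in
  its extent, and the extent of \<open>mu K m\<close> consists of the objects incident with
  \<open>m\<close>. So the coded pair of \<open>gamma\<close> and \<open>mu\<close> preserves and
  reflects incidence.\<close>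

lemma incid_base_BK:
  assumes "j \<in> objs K" "m \<in> attrs K"
  shows "(code (gamma K j), code (mu K m)) \<in> incid (base_context BK) \<longleftrightarrow> (j, m) \<in> incid K"
proof -
  have "code (gamma K j) \<sqsubseteq>\<^bsub>lat BK\<^esub> code (mu K m) \<longleftrightarrow> j \<in> fst (mu K m)"
    using assms by (simp add: gamma_concept mu_concept gamma_le_iff)
  also have "\<dots> \<longleftrightarrow> (j, m) \<in> incid K"
    using assms by (simp add: mu_def down_def)
  finally show ?thesis
    using assms by (simp add: base_context_def)
qed

lemma bij_gamma: "purified_context K \<Longrightarrow> bij_betw (\<lambda>j \<in> objs K. code (gamma K j)) (objs K) (jbase BK)"
  and bij_mu: "purified_context K \<Longrightarrow> bij_betw (\<lambda>m \<in> attrs K. code (mu K m)) (attrs K) (mbase BK)"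
  using comp_inj_on[OF _ inj_on_subset[OF inj_code gamma_image[OF subset_refl]]]
    comp_inj_on[OF _ inj_on_subset[OF inj_code mu_image[OF subset_refl]]]
  by (simp_all add: bij_betw_def purified_context_def inj_on_restrict_eq image_image o_def)

end

text \<open>The lifted maps are forced. A concept is the join of the object concepts of its extent,
  \<open>\<phi>\<close> carries these to the object concepts of the image under
  \<open>\<alpha>\<close>, and their join is the concept which that image generates. The argument
  for \<open>\<psi>\<close> is dual.\<close>

lemma lift_eq:
  fixes K :: "('a, 'b) fcontext" and L :: "('c, 'd) fcontext"
    and code :: "'a set \<times> 'b set \<Rightarrow> 'u" and code' :: "'c set \<times> 'd set \<Rightarrow> 'v"
  assumes "encoded_context K code" "encoded_context L code'"
    and maps: "(\<alpha>, \<beta>) \<in> mapping_pairs K L"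
    and "(\<phi>, \<psi>) \<in> CLjm_morphisms (rename_lattice code (augmented_lattice K))
      (rename_lattice code' (augmented_lattice L))"
    and gamma: "\<And>j. j \<in> objs K \<Longrightarrow> \<phi> (code (gamma K j)) = code' (gamma L (\<alpha> j))"
    and mu: "\<And>m. m \<in> attrs K \<Longrightarrow> \<psi> (code (mu K m)) = code' (mu L (\<beta> m))"
    and c: "c \<in> concepts K"
  shows "\<phi> (code c) = code' (alpha_lift L \<alpha> c)" and "\<psi> (code c) = code' (beta_lift L \<beta> c)"
proof -
  interpret K: encoded_context K code by fact
  interpret L: encoded_context L code' by fact
  obtain A B where AB: "c = (A, B)" by fastforce
  have sub: "A \<subseteq> objs K" "B \<subseteq> attrs K"
    using conceptD(1,2)[OF c] by (simp_all add: AB)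
  have img: "\<alpha> ` A \<subseteq> objs L" "\<beta> ` B \<subseteq> attrs L"
    using maps sub by (auto simp: mapping_pairs_def)
  have "code ` gamma K ` A \<subseteq> lcarrier K.BK" "code ` mu K ` B \<subseteq> lcarrier K.BK"
    using image_mono[OF gamma_image] image_mono[OF mu_image] sub by simp_all
  then have "\<phi> (code c) = \<Squnion>\<^bsub>lat L.BK\<^esub> (\<phi> ` code ` gamma K ` A)"
    and "\<psi> (code c) = \<Sqinter>\<^bsub>lat L.BK\<^esub> (\<psi> ` code ` mu K ` B)"
    using assms(4) K.concept_sup_gamma[OF c] K.concept_inf_mu[OF c]
    by (auto simp: CLjm_morphisms_def preserves_joins_def preserves_meets_def AB)
  moreover have "\<phi> ` code ` gamma K ` A = code' ` gamma L ` \<alpha> ` A"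
    and "\<psi> ` code ` mu K ` B = code' ` mu L ` \<beta> ` B"
    using sub gamma mu by (simp_all add: image_image subset_iff cong: image_cong_simp)
  ultimately show "\<phi> (code c) = code' (alpha_lift L \<alpha> c)" "\<psi> (code c) = code' (beta_lift L \<beta> c)"
    using img by (simp_all add: L.sup_gamma L.inf_mu alpha_lift_def beta_lift_def AB)
qed

lemma rename_map_eq:
  assumes "\<phi> \<in> extensional (code ` lcarrier X)" "inj_on code (lcarrier X)"
    and "\<And>c. c \<in> lcarrier X \<Longrightarrow> \<phi> (code c) = code (f c)"
  shows "rename_map code X f = \<phi>"
  by (rule extensionalityI[OF _ assms(1)]) (use assms(2,3) in \<open>auto simp: rename_map_def\<close>)

text \<open>The maps commute with both derivations, through images as well as preimages. Hence
  preimages of extents and intents are again such, and the image of a concept is already a concept,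
  with no closure to be taken.\<close>

lemma context_iso_conceptual:
  assumes a: "bij_betw a (objs K) (objs L)" "a \<in> extensional (objs K)"
    and b: "bij_betw b (attrs K) (attrs L)" "b \<in> extensional (attrs K)"
    and incid: "\<And>j m. j \<in> objs K \<Longrightarrow> m \<in> attrs K \<Longrightarrow> (a j, b m) \<in> incid L \<longleftrightarrow> (j, m) \<in> incid K"
  shows "(a, b) \<in> mapping_pairs K L" and "conceptual K L (a, b)"
proof -
  have a_img: "a ` objs K = objs L" and b_img: "b ` attrs K = attrs L"
    using a b by (simp_all add: bij_betw_def)
  show "(a, b) \<in> mapping_pairs K L"
    using a(2) b(2) a_img b_img by (auto simp: mapping_pairs_def PiE_def)
  have surj: "f ` (f -` S \<inter> Z) = S" if "S \<subseteq> f ` Z" for f :: "'x \<Rightarrow> 'y" and S Z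
    using that by auto
  have pre_down': "a -` down L (b ` B) \<inter> objs K = down K B" if "B \<subseteq> attrs K" for B
    using that a_img incid by (auto simp: down_def subset_iff)
  have pre_up': "b -` up L (a ` A) \<inter> attrs K = up K A" if "A \<subseteq> objs K" for A
    using that b_img incid by (auto simp: up_def subset_iff)
  have pre_down: "a -` down L D \<inter> objs K = down K (b -` D \<inter> attrs K)" if "D \<subseteq> attrs L" for D
    using pre_down'[of "b -` D \<inter> attrs K"] surj[of D b "attrs K"] that b_img by simp
  have pre_up: "b -` up L D \<inter> attrs K = up K (a -` D \<inter> objs K)" if "D \<subseteq> objs L" for D
    using pre_up'[of "a -` D \<inter> objs K"] surj[of D a "objs K"] that a_img by simp
  have down_img: "down L (b ` B) = a ` down K B" if "B \<subseteq> attrs K" for B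
    using pre_down'[OF that] surj[of "down L (b ` B)" a "objs K"] a_img down_subset[of L] by simp
  have up_img: "up L (a ` A) = b ` up K A" if "A \<subseteq> objs K" for A
    using pre_up'[OF that] surj[of "up L (a ` A)" b "attrs K"] b_img up_subset[of L] by simp
  have "separately_continuous K L (a, b)"
    unfolding separately_continuous_def
    \<comment> \<open>Intents are rewritten as extents of the dual context, so that
      \<open>extents_eq\<close> describes them as well.\<close>
    by (auto simp: extents_eq pre_down) (auto simp: extents_eq pre_up simp flip: dual_context_simps(5))
  moreover have "(down L (b ` B), up L (a ` A)) \<in> concepts L" if "(A, B) \<in> concepts K" for A B
  proof -
    from that have AB: "A \<subseteq> objs K" "B \<subseteq> attrs K" "down K B = A" "up K A = B"
      by (simp_all add: concepts_iff)
    then have "down L (b ` B) = a ` A" "up L (a ` A) = b ` B"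
      by (simp_all add: down_img up_img)
    with AB image_mono[OF AB(1), of a] image_mono[OF AB(2), of b] a_img b_img show ?thesis
      by (simp add: concepts_iff down_img up_img)
  qed
  ultimately show "conceptual K L (a, b)"
    by (auto simp: conceptual_def)
qed

section \<open>The four categories\<close>

lemma separately_continuous_idt:
  "separately_continuous K K (\<lambda>j \<in> objs K. j, \<lambda>m \<in> attrs K. m)"
proof -
  have id: "(\<lambda>x \<in> A. x) -` E \<inter> A = E" if "E \<subseteq> A" for A E :: "'x set"
    using that by auto
  have "E \<in> extents K \<Longrightarrow> E \<subseteq> objs K" "D \<in> intents K \<Longrightarrow> D \<subseteq> attrs K" for E D
    by (simp_all add: extents_def intents_def)
  then show ?thesis
    by (simp add: separately_continuous_def id)
qed

lemma separately_continuous_compose: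
  assumes maps: "(\<alpha>, \<beta>) \<in> mapping_pairs K L"
    and cont: "separately_continuous K L (\<alpha>, \<beta>)" "separately_continuous L N (\<alpha>', \<beta>')"
  shows "separately_continuous K N (compose (objs K) \<alpha>' \<alpha>, compose (attrs K) \<beta>' \<beta>)"
proof -
  have pre: "compose A g f -` E \<inter> A = f -` (g -` E \<inter> B) \<inter> A" if "f \<in> A \<rightarrow>\<^sub>E B"
    for f :: "'x \<Rightarrow> 'y" and g :: "'y \<Rightarrow> 'z" and A B E
    using that by (auto simp: compose_def)
  have "\<alpha> \<in> objs K \<rightarrow>\<^sub>E objs L" "\<beta> \<in> attrs K \<rightarrow>\<^sub>E attrs L"
    using maps by (simp_all add: mapping_pairs_def)
  with cont show ?thesis
    by (simp add: separately_continuous_def pre del: vimage_Int)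
qed

lemma mapping_pairs_idt: "(\<lambda>j \<in> objs K. j, \<lambda>m \<in> attrs K. m) \<in> mapping_pairs K K"
  by (simp add: mapping_pairs_def)

lemma mapping_pairs_compose:
  "(\<alpha>, \<beta>) \<in> mapping_pairs K L \<Longrightarrow> (\<alpha>', \<beta>') \<in> mapping_pairs L N \<Longrightarrow>
    (compose (objs K) \<alpha>' \<alpha>, compose (attrs K) \<beta>' \<beta>) \<in> mapping_pairs K N"
  by (auto simp: mapping_pairs_def compose_def)

lemma closure_mono: "A \<subseteq> A' \<Longrightarrow> down K (up K A) \<subseteq> down K (up K A')"
  by (auto simp: up_def down_def)

text \<open>An attribute \<open>m\<close> belongs to the derivation of the image of \<open>A\<close>
  iff \<open>A\<close> lies in the preimage of the extent of \<open>m\<close>. That preimage is an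
  extent, so it contains \<open>A\<close> iff it contains the closure of \<open>A\<close>.\<close>

lemma up_image_closure:
  assumes \<alpha>: "\<alpha> \<in> objs K \<rightarrow> objs L"
    and cont: "\<And>E. E \<in> extents L \<Longrightarrow> \<alpha> -` E \<inter> objs K \<in> extents K"
    and A: "A \<subseteq> objs K"
  shows "up L (\<alpha> ` down K (up K A)) = up L (\<alpha> ` A)"
proof
  show "up L (\<alpha> ` down K (up K A)) \<subseteq> up L (\<alpha> ` A)"
    using A by (auto simp: up_def down_def)
  show "up L (\<alpha> ` A) \<subseteq> up L (\<alpha> ` down K (up K A))"
  proof
    fix m assume m: "m \<in> up L (\<alpha> ` A)"
    let ?E = "\<alpha> -` down L {m} \<inter> objs K"
    have "down L {m} \<in> extents L"
      unfolding extents_eq using m by (auto simp: up_def)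
    then have "?E \<in> extents K" by (rule cont)
    then have E: "down K (up K ?E) = ?E" by (simp add: extents_def)
    have "A \<subseteq> ?E"
      using m A \<alpha> by (auto simp: up_def down_def)
    then have "down K (up K A) \<subseteq> down K (up K ?E)"
      by (rule closure_mono)
    then have "down K (up K A) \<subseteq> ?E" by (simp only: E)
    with m show "m \<in> up L (\<alpha> ` down K (up K A))"
      by (auto simp: up_def down_def)
  qed
qed

lemma conceptual_idt: "conceptual K K (\<lambda>j \<in> objs K. j, \<lambda>m \<in> attrs K. m)"
proof -
  have "(down K ((\<lambda>m \<in> attrs K. m) ` B), up K ((\<lambda>j \<in> objs K. j) ` A)) \<in> concepts K"
    if c: "(A, B) \<in> concepts K" for A B
  proof -
    have "(\<lambda>j \<in> objs K. j) ` A = A" "(\<lambda>m \<in> attrs K. m) ` B = B"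
      using conceptD(1,2)[OF c] by force+
    with c show ?thesis by (simp add: concepts_iff)
  qed
  then show ?thesis
    using separately_continuous_idt[of K] by (auto simp: conceptual_def)
qed

lemma compose_image: "S \<subseteq> A \<Longrightarrow> compose A g f ` S = g ` f ` S"
  by (force simp: compose_def)

text \<open>Applying the second pair to the concept produced by the first yields derivations of
  images of closed sets. By continuity of the second pair, \<open>up_image_closure\<close> and its
  dual remove these inner closures and leave the composite.\<close>

lemma conceptual_compose:
  assumes maps: "(\<alpha>, \<beta>) \<in> mapping_pairs K L" "(\<alpha>', \<beta>') \<in> mapping_pairs L N"
    and "conceptual K L (\<alpha>, \<beta>)" "conceptual L N (\<alpha>', \<beta>')"
  shows "conceptual K N (compose (objs K) \<alpha>' \<alpha>, compose (attrs K) \<beta>' \<beta>)"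
proof -
  have cont: "separately_continuous K L (\<alpha>, \<beta>)" "separately_continuous L N (\<alpha>', \<beta>')"
    and concept: "\<And>A B. (A, B) \<in> concepts K \<Longrightarrow> (down L (\<beta> ` B), up L (\<alpha> ` A)) \<in> concepts L"
      "\<And>A B. (A, B) \<in> concepts L \<Longrightarrow> (down N (\<beta>' ` B), up N (\<alpha>' ` A)) \<in> concepts N"
    using assms(3,4) by (auto simp: conceptual_def)
  have "(down N (compose (attrs K) \<beta>' \<beta> ` B), up N (compose (objs K) \<alpha>' \<alpha> ` A)) \<in> concepts N"
    if c: "(A, B) \<in> concepts K" for A B
  proof -
    have AB: "A \<subseteq> objs K" "B \<subseteq> attrs K"
      using conceptD(1,2)[OF c] by simp_all
    have img: "compose (objs K) \<alpha>' \<alpha> ` A = \<alpha>' ` \<alpha> ` A" "compose (attrs K) \<beta>' \<beta> ` B = \<beta>' ` \<beta> ` B"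
      using AB by (simp_all only: compose_image)
    have sub: "\<alpha> ` A \<subseteq> objs L" "\<beta> ` B \<subseteq> attrs L"
      using AB maps(1) by (auto simp: mapping_pairs_def)
    have eqs: "down L (up L (\<alpha> ` A)) = down L (\<beta> ` B)" "up L (down L (\<beta> ` B)) = up L (\<alpha> ` A)"
      using conceptD(3,4)[OF concept(1)[OF c]] by simp_all
    have \<alpha>': "\<alpha>' \<in> objs L \<rightarrow> objs N" and \<beta>': "\<beta>' \<in> attrs L \<rightarrow> attrs N"
      using maps(2) by (auto simp: mapping_pairs_def)
    have "up N (\<alpha>' ` down L (up L (\<alpha> ` A))) = up N (\<alpha>' ` \<alpha> ` A)"
      using \<alpha>' cont(2) sub(1) by (intro up_image_closure) (auto simp: separately_continuous_def)
    moreover have "down N (\<beta>' ` up L (down L (\<beta> ` B))) = down N (\<beta>' ` \<beta> ` B)"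
      using up_image_closure[of \<beta>' "dual_context L" "dual_context N" "\<beta> ` B"] \<beta>' cont(2) sub(2)
      by (simp add: separately_continuous_def)
    ultimately show ?thesis
      using concept(2)[OF concept(1)[OF c]] by (simp add: img eqs)
  qed
  then show ?thesis
    using separately_continuous_compose[OF maps(1) cont] by (auto simp: conceptual_def)
qed

section \<open>Identities and composites of lattice morphisms\<close>

lemma preserves_joins_idt: "complete_lattice L \<Longrightarrow> preserves_joins L L (\<lambda>x \<in> carrier L. x)"
  and preserves_meets_idt: "complete_lattice L \<Longrightarrow> preserves_meets L L (\<lambda>x \<in> carrier L. x)"
proof -
  assume "complete_lattice L"
  then interpret complete_lattice L .
  have "(\<lambda>x \<in> carrier L. x) ` S = S" if "S \<subseteq> carrier L" for S
    using that by force
  then show "preserves_joins L L (\<lambda>x \<in> carrier L. x)" "preserves_meets L L (\<lambda>x \<in> carrier L. x)"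
    by (simp_all add: preserves_joins_def preserves_meets_def)
qed

lemma preserves_joins_compose:
  assumes "complete_lattice K" and f: "f \<in> carrier K \<rightarrow> carrier L"
    and "preserves_joins K L f" "preserves_joins L N g"
  shows "preserves_joins K N (compose (carrier K) g f)"
  unfolding preserves_joins_def
proof (intro allI impI)
  interpret K: complete_lattice K by fact
  fix S assume S: "S \<subseteq> carrier K"
  have "f ` S \<subseteq> carrier L" using f S by blast
  moreover have "compose (carrier K) g f ` S = g ` f ` S"
    using S by (rule compose_image)
  ultimately show "compose (carrier K) g f (\<Squnion>\<^bsub>K\<^esub> S) = \<Squnion>\<^bsub>N\<^esub> (compose (carrier K) g f ` S)"
    using assms(3,4) S by (simp add: compose_def preserves_joins_def)
qed

lemma preserves_meets_compose:
  assumes "complete_lattice K" "f \<in> carrier K \<rightarrow> carrier L"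
    and "preserves_meets K L f" "preserves_meets L N g"
  shows "preserves_meets K N (compose (carrier K) g f)"
  using preserves_joins_compose[of "inv_gorder K" f "inv_gorder L" "inv_gorder N" g]
    complete_lattice.dual_complete_lattice[OF assms(1)] assms(2-4)
  by simp

lemma CLjm_morphisms_idt:
  "doubly_based_lattice X \<Longrightarrow> (\<lambda>x \<in> lcarrier X. x, \<lambda>x \<in> lcarrier X. x) \<in> CLjm_morphisms X X"
  by (auto simp: CLjm_morphisms_def doubly_based_lattice_def preserves_joins_idt preserves_meets_idt)

lemma CLjm_morphisms_compose:
  assumes X: "doubly_based_lattice X"
    and f: "(\<phi>, \<psi>) \<in> CLjm_morphisms X Y" and g: "(\<phi>', \<psi>') \<in> CLjm_morphisms Y Z"
  shows "(compose (lcarrier X) \<phi>' \<phi>, compose (lcarrier X) \<psi>' \<psi>) \<in> CLjm_morphisms X Z"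
proof -
  have X': "complete_lattice (lat X)" "jbase X \<subseteq> lcarrier X" "mbase X \<subseteq> lcarrier X"
    using X by (simp_all add: doubly_based_lattice_def)
  from f have f': "\<phi> \<in> lcarrier X \<rightarrow> lcarrier Y" "\<psi> \<in> lcarrier X \<rightarrow> lcarrier Y"
      "preserves_joins (lat X) (lat Y) \<phi>" "preserves_meets (lat X) (lat Y) \<psi>"
      "\<phi> ` jbase X \<subseteq> jbase Y" "\<psi> ` mbase X \<subseteq> mbase Y"
    by (auto simp: CLjm_morphisms_def)
  from g have g': "\<phi>' \<in> lcarrier Y \<rightarrow> lcarrier Z" "\<psi>' \<in> lcarrier Y \<rightarrow> lcarrier Z"
      "preserves_joins (lat Y) (lat Z) \<phi>'" "preserves_meets (lat Y) (lat Z) \<psi>'"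
      "\<phi>' ` jbase Y \<subseteq> jbase Z" "\<psi>' ` mbase Y \<subseteq> mbase Z"
    by (auto simp: CLjm_morphisms_def)
  have "compose (lcarrier X) \<phi>' \<phi> ` jbase X \<subseteq> jbase Z" "compose (lcarrier X) \<psi>' \<psi> ` mbase X \<subseteq> mbase Z"
    using subset_trans[OF image_mono[OF f'(5)] g'(5)] subset_trans[OF image_mono[OF f'(6)] g'(6)]
    by (simp_all only: compose_image[OF X'(2)] compose_image[OF X'(3)])
  moreover have "compose (lcarrier X) \<phi>' \<phi> \<in> lcarrier X \<rightarrow>\<^sub>E lcarrier Z"
    "compose (lcarrier X) \<psi>' \<psi> \<in> lcarrier X \<rightarrow>\<^sub>E lcarrier Z"
    using funcset_compose[OF f'(1) g'(1)] funcset_compose[OF f'(2) g'(2)] by (simp_all add: PiE_def)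
  ultimately show ?thesis
    using preserves_joins_compose[OF X'(1) f'(1,3) g'(3)]
      preserves_meets_compose[OF X'(1) f'(2,4) g'(4)]
    by (simp add: CLjm_morphisms_def)
qed

lemma CL_morphisms_iff: "\<phi> \<in> CL_morphisms X Y \<longleftrightarrow> (\<phi>, \<phi>) \<in> CLjm_morphisms X Y"
  by (auto simp: CL_morphisms_def CLjm_morphisms_def)

section \<open>The category axioms\<close>

lemma Cjm_simps [simp]:
  "obj (Cjm small code) = {K. purified_context K \<and> small_context small code K}"
  "hom (Cjm small code) K L = {p \<in> mapping_pairs K L. separately_continuous K L p}"
  "idt (Cjm small code) K = (\<lambda>j \<in> objs K. j, \<lambda>m \<in> attrs K. m)"
  "cmp (Cjm small code) K L N (\<alpha>', \<beta>') (\<alpha>, \<beta>) =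
    (compose (objs K) \<alpha>' \<alpha>, compose (attrs K) \<beta>' \<beta>)"
  by (simp_all add: Cjm_def)

lemma Cc_simps [simp]:
  "obj (Cc small code) = obj (Cjm small code)"
  "hom (Cc small code) K L = {p \<in> mapping_pairs K L. conceptual K L p}"
  "idt (Cc small code) = idt (Cjm small code)"
  "cmp (Cc small code) = cmp (Cjm small code)"
  by (simp_all add: Cc_def)

lemma CLjm_simps [simp]:
  "obj (CLjm small) = {X. doubly_based_lattice X \<and> small (lcarrier X)}"
  "hom (CLjm small) = CLjm_morphisms"
  "idt (CLjm small) X = (\<lambda>x \<in> lcarrier X. x, \<lambda>x \<in> lcarrier X. x)"
  "cmp (CLjm small) X Y Z (\<phi>', \<psi>') (\<phi>, \<psi>) =
    (compose (lcarrier X) \<phi>' \<phi>, compose (lcarrier X) \<psi>' \<psi>)"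
  by (simp_all add: CLjm_def)

lemma CL_simps [simp]:
  "obj (CL small) = obj (CLjm small)"
  "hom (CL small) = CL_morphisms"
  "idt (CL small) X = (\<lambda>x \<in> lcarrier X. x)"
  "cmp (CL small) X Y Z \<phi>' \<phi> = compose (lcarrier X) \<phi>' \<phi>"
  by (simp_all add: CL_def CLjm_def)

lemma Co_simps [simp]:
  "ob_map Co_jm = base_context" "ob_map Co_c = base_context"
  "arr_map Co_jm X Y (\<phi>, \<psi>) = (restrict \<phi> (jbase X), restrict \<psi> (mbase X))"
  "arr_map Co_c X Y \<phi> = (restrict \<phi> (jbase X), restrict \<phi> (mbase X))"
  by (simp_all add: Co_jm_def Co_c_def)

lemma conceptual_separately_continuous: "conceptual K L p \<Longrightarrow> separately_continuous K L p"
  by (auto simp: conceptual_def)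

lemma compose_laws:
  assumes "f \<in> A \<rightarrow>\<^sub>E B"
  shows "compose A f (\<lambda>x \<in> A. x) = f" and "compose A (\<lambda>y \<in> B. y) f = f"
    and "compose A (compose B h g) f = compose A h (compose A g f)"
  using assms by (auto simp: PiE_def intro!: compose_Id Id_compose compose_assoc[symmetric])

lemma mapping_pairs_cmp_laws:
  assumes "(\<alpha>, \<beta>) \<in> mapping_pairs K L"
  shows "(compose (objs K) \<alpha> (\<lambda>j \<in> objs K. j), compose (attrs K) \<beta> (\<lambda>m \<in> attrs K. m)) = (\<alpha>, \<beta>)"
      (is ?A)
    and "(compose (objs K) (\<lambda>j \<in> objs L. j) \<alpha>, compose (attrs K) (\<lambda>m \<in> attrs L. m) \<beta>) = (\<alpha>, \<beta>)"
      (is ?B)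
    and "compose (objs K) (compose (objs L) \<alpha>'' \<alpha>') \<alpha> = compose (objs K) \<alpha>'' (compose (objs K) \<alpha>' \<alpha>)"
      (is ?C)
    and "compose (attrs K) (compose (attrs L) \<beta>'' \<beta>') \<beta> = compose (attrs K) \<beta>'' (compose (attrs K) \<beta>' \<beta>)"
      (is ?D)
proof -
  have \<alpha>: "\<alpha> \<in> objs K \<rightarrow>\<^sub>E objs L" and \<beta>: "\<beta> \<in> attrs K \<rightarrow>\<^sub>E attrs L"
    using assms by (simp_all add: mapping_pairs_def)
  show ?A ?B ?C ?D
    by (simp_all add: compose_laws[OF \<alpha>] compose_laws[OF \<beta>])
qed

lemma category_Cjm: "category (Cjm small code)"
proof
  fix X :: "('a, 'a) fcontext"
  show "idt (Cjm small code) X \<in> hom (Cjm small code) X X"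
    by (simp add: mapping_pairs_idt separately_continuous_idt)
next
  fix X Y Z :: "('a, 'a) fcontext" and f g
  assume "f \<in> hom (Cjm small code) X Y" "g \<in> hom (Cjm small code) Y Z"
  then show "cmp (Cjm small code) X Y Z g f \<in> hom (Cjm small code) X Z"
    by (cases f; cases g) (auto intro: mapping_pairs_compose separately_continuous_compose)
next
  fix X Y :: "('a, 'a) fcontext" and f
  assume "f \<in> hom (Cjm small code) X Y"
  then show "cmp (Cjm small code) X X Y f (idt (Cjm small code) X) = f"
    and "cmp (Cjm small code) X Y Y (idt (Cjm small code) Y) f = f"
    using mapping_pairs_cmp_laws(1,2)[of "fst f" "snd f" X Y] by (cases f; simp)+
next
  fix W X Y Z :: "('a, 'a) fcontext" and f g h :: "('a \<Rightarrow> 'a) \<times> ('a \<Rightarrow> 'a)"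
  assume "f \<in> hom (Cjm small code) W X"
  moreover obtain \<alpha> \<beta> \<alpha>' \<beta>' \<alpha>'' \<beta>'' where "f = (\<alpha>, \<beta>)" "g = (\<alpha>', \<beta>')" "h = (\<alpha>'', \<beta>'')"
    by (cases f; cases g; cases h)
  ultimately show "cmp (Cjm small code) W X Z (cmp (Cjm small code) X Y Z h g) f =
      cmp (Cjm small code) W Y Z h (cmp (Cjm small code) W X Y g f)"
    using mapping_pairs_cmp_laws(3)[of \<alpha> \<beta> W X \<alpha>'' \<alpha>']
      mapping_pairs_cmp_laws(4)[of \<alpha> \<beta> W X \<beta>'' \<beta>'] by simp
qed

text \<open>A subcategory of \<open>Cjm\<close> with the same objects, identities and composition:
  the equations are inherited, while conceptuality of identities and composites is supplied
  separately.\<close>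

lemma category_Cc: "category (Cc small code)"
proof -
  interpret Cjm: category "Cjm small code" by (rule category_Cjm)
  have sub: "f \<in> hom (Cc small code) K L \<Longrightarrow> f \<in> hom (Cjm small code) K L"
    for f and K L :: "('a, 'a) fcontext"
    by (auto intro: conceptual_separately_continuous)
  show ?thesis
  proof
    fix X :: "('a, 'a) fcontext"
    show "idt (Cc small code) X \<in> hom (Cc small code) X X"
      by (simp add: mapping_pairs_idt conceptual_idt)
  next
    fix X Y Z :: "('a, 'a) fcontext" and f g
    assume "f \<in> hom (Cc small code) X Y" "g \<in> hom (Cc small code) Y Z"
    then show "cmp (Cc small code) X Y Z g f \<in> hom (Cc small code) X Z"
      by (cases f; cases g) (auto intro: mapping_pairs_compose conceptual_compose)
  next
    fix X Y :: "('a, 'a) fcontext" and f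
    assume "X \<in> obj (Cc small code)" "Y \<in> obj (Cc small code)" "f \<in> hom (Cc small code) X Y"
    then show "cmp (Cc small code) X X Y f (idt (Cc small code) X) = f"
      and "cmp (Cc small code) X Y Y (idt (Cc small code) Y) f = f"
      using Cjm.cmp_idt_right[of X Y f] Cjm.cmp_idt_left[of X Y f] sub[of f X Y]
      by (simp_all only: Cc_simps(1,3,4))
  next
    fix W X Y Z :: "('a, 'a) fcontext" and f g h
    assume "W \<in> obj (Cc small code)" "X \<in> obj (Cc small code)"
      "Y \<in> obj (Cc small code)" "Z \<in> obj (Cc small code)"
      "f \<in> hom (Cc small code) W X" "g \<in> hom (Cc small code) X Y" "h \<in> hom (Cc small code) Y Z"
    then show "cmp (Cc small code) W X Z (cmp (Cc small code) X Y Z h g) f =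
        cmp (Cc small code) W Y Z h (cmp (Cc small code) W X Y g f)"
      using Cjm.cmp_assoc[of W X Y Z f g h] sub[of f W X] sub[of g X Y] sub[of h Y Z]
      by (simp only: Cc_simps(1,4))
  qed
qed

lemma category_CLjm: "category (CLjm small)"
proof
  fix X :: "'a based_lattice"
  assume "X \<in> obj (CLjm small)"
  then show "idt (CLjm small) X \<in> hom (CLjm small) X X"
    by (simp add: CLjm_morphisms_idt)
next
  fix X Y Z :: "'a based_lattice" and f g
  assume "X \<in> obj (CLjm small)" "f \<in> hom (CLjm small) X Y" "g \<in> hom (CLjm small) Y Z"
  then show "cmp (CLjm small) X Y Z g f \<in> hom (CLjm small) X Z"
    by (cases f; cases g) (auto intro: CLjm_morphisms_compose)
next
  fix X Y :: "'a based_lattice" and f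
  assume f: "f \<in> hom (CLjm small) X Y"
  obtain \<phi> \<psi> where \<phi>\<psi>: "f = (\<phi>, \<psi>)" by (cases f)
  then have \<phi>: "\<phi> \<in> lcarrier X \<rightarrow>\<^sub>E lcarrier Y" and \<psi>: "\<psi> \<in> lcarrier X \<rightarrow>\<^sub>E lcarrier Y"
    using f by (simp_all add: CLjm_morphisms_def)
  show "cmp (CLjm small) X X Y f (idt (CLjm small) X) = f"
    and "cmp (CLjm small) X Y Y (idt (CLjm small) Y) f = f"
    by (simp_all add: \<phi>\<psi> compose_laws[OF \<phi>] compose_laws[OF \<psi>])
next
  fix W X Y Z :: "'a based_lattice" and f g h :: "('a \<Rightarrow> 'a) \<times> ('a \<Rightarrow> 'a)"
  assume f: "f \<in> hom (CLjm small) W X"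
  obtain \<phi> \<psi> \<phi>' \<psi>' \<phi>'' \<psi>'' where fgh: "f = (\<phi>, \<psi>)" "g = (\<phi>', \<psi>')" "h = (\<phi>'', \<psi>'')"
    by (cases f; cases g; cases h)
  then have \<phi>: "\<phi> \<in> lcarrier W \<rightarrow>\<^sub>E lcarrier X" and \<psi>: "\<psi> \<in> lcarrier W \<rightarrow>\<^sub>E lcarrier X"
    using f by (simp_all add: CLjm_morphisms_def)
  show "cmp (CLjm small) W X Z (cmp (CLjm small) X Y Z h g) f =
      cmp (CLjm small) W Y Z h (cmp (CLjm small) W X Y g f)"
    by (simp add: fgh compose_laws[OF \<phi>] compose_laws[OF \<psi>])
qed

text \<open>The axioms are those of \<open>CLjm\<close> on the diagonal pairs, to which
  \<open>CL_morphisms_iff\<close> reduces a complete homomorphism.\<close>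

lemma category_CL: "category (CL small)"
proof -
  interpret CLjm: category "CLjm small" by (rule category_CLjm)
  show ?thesis
  proof
    fix X :: "'a based_lattice"
    assume "X \<in> obj (CL small)"
    then show "idt (CL small) X \<in> hom (CL small) X X"
      by (simp add: CL_morphisms_iff CLjm_morphisms_idt)
  next
    fix X Y Z :: "'a based_lattice" and f g
    assume "X \<in> obj (CL small)" "f \<in> hom (CL small) X Y" "g \<in> hom (CL small) Y Z"
    then show "cmp (CL small) X Y Z g f \<in> hom (CL small) X Z"
      by (auto simp: CL_morphisms_iff intro: CLjm_morphisms_compose)
  next
    fix X Y :: "'a based_lattice" and f
    assume "X \<in> obj (CL small)" "Y \<in> obj (CL small)" "f \<in> hom (CL small) X Y"
    then show "cmp (CL small) X X Y f (idt (CL small) X) = f"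
      and "cmp (CL small) X Y Y (idt (CL small) Y) f = f"
      using CLjm.cmp_idt_right[of X Y "(f, f)"] CLjm.cmp_idt_left[of X Y "(f, f)"]
      by (simp_all add: CL_morphisms_iff)
  next
    fix W X Y Z :: "'a based_lattice" and f g h
    assume "W \<in> obj (CL small)" "X \<in> obj (CL small)" "Y \<in> obj (CL small)" "Z \<in> obj (CL small)"
      "f \<in> hom (CL small) W X" "g \<in> hom (CL small) X Y" "h \<in> hom (CL small) Y Z"
    then show "cmp (CL small) W X Z (cmp (CL small) X Y Z h g) f =
        cmp (CL small) W Y Z h (cmp (CL small) W X Y g f)"
      using CLjm.cmp_assoc[of W X Y Z "(f, f)" "(g, g)" "(h, h)"] by (simp add: CL_morphisms_iff)
  qed
qed

section \<open>The equivalences\<close>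

text \<open>The inverse maps are again bijective and compatible with incidence, so
  \<open>context_iso_conceptual\<close> applies to them too and the inverse pair is a morphism in
  both categories.\<close>

lemma context_iso_is_iso:
  assumes a: "bij_betw a (objs K) (objs L)" "a \<in> extensional (objs K)"
    and b: "bij_betw b (attrs K) (attrs L)" "b \<in> extensional (attrs K)"
    and incid: "\<And>j m. j \<in> objs K \<Longrightarrow> m \<in> attrs K \<Longrightarrow> (a j, b m) \<in> incid L \<longleftrightarrow> (j, m) \<in> incid K"
  shows "is_iso (Cc small code) K L (a, b)" and "is_iso (Cjm small code) K L (a, b)"
proof -
  let ?a = "\<lambda>x \<in> objs L. inv_into (objs K) a x" and ?b = "\<lambda>x \<in> attrs L. inv_into (attrs K) b x"
  have ab: "(a, b) \<in> mapping_pairs K L" "conceptual K L (a, b)"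
    using context_iso_conceptual[OF assms] by simp_all
  have bij: "bij_betw ?a (objs L) (objs K)" "bij_betw ?b (attrs L) (attrs K)"
    using bij_betw_inv_into[OF a(1)] bij_betw_inv_into[OF b(1)] by (simp_all add: bij_betw_restrict_eq)
  have "(?a j, ?b m) \<in> incid K \<longleftrightarrow> (j, m) \<in> incid L" if "j \<in> objs L" "m \<in> attrs L" for j m
    using that incid[of "inv_into (objs K) a j" "inv_into (attrs K) b m"] a(1) b(1)
    by (simp add: bij_betw_def inv_into_into f_inv_into_f)
  then have inv_ab: "(?a, ?b) \<in> mapping_pairs L K" "conceptual L K (?a, ?b)"
    using context_iso_conceptual[OF bij(1) restrict_extensional bij(2) restrict_extensional] by blast+
  have "compose (objs K) ?a a = (\<lambda>j \<in> objs K. j)" "compose (attrs K) ?b b = (\<lambda>m \<in> attrs K. m)"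
    "compose (objs L) a ?a = (\<lambda>j \<in> objs L. j)" "compose (attrs L) b ?b = (\<lambda>m \<in> attrs L. m)"
    using a(1) b(1) by (simp_all add: compose_inv_into_id compose_id_inv_into bij_betw_def)
  with ab inv_ab show "is_iso (Cc small code) K L (a, b)" "is_iso (Cjm small code) K L (a, b)"
    unfolding is_iso_def
    by (intro conjI bexI[of _ "(?a, ?b)"]; simp add: conceptual_separately_continuous)+
qed

lemma restrict_compose_restrict:
  assumes "f ` B \<subseteq> B'" "B \<subseteq> A"
  shows "restrict (compose A g f) B = compose B (restrict g B') (restrict f B)"
  using assms by (auto simp: compose_def restrict_def fun_eq_iff)

text \<open>The coded pair of \<open>gamma\<close> and \<open>mu\<close>: the unit of both
  equivalences.\<close>

definition eta :: "('u set \<times> 'u set \<Rightarrow> 'u) \<Rightarrow> ('u, 'u) fcontext \<Rightarrow> ('u \<Rightarrow> 'u) \<times> ('u \<Rightarrow> 'u)" where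
  "eta code K = (\<lambda>j \<in> objs K. code (gamma K j), \<lambda>m \<in> attrs K. code (mu K m))"

section \<open>Smallness, the functors C^o, and the two equivalences\<close>

context universe
begin

text \<open>Extents and intents are subsets of small sets, hence small, and \<open>code\<close> is
  injective on pairs of small sets.\<close>

lemma encoded: "small_context small code K \<Longrightarrow> encoded_context K code"
proof
  assume K: "small_context small code K"
  have "concepts K \<subseteq> {A. small A} \<times> {A. small A}"
  proof
    fix c assume "c \<in> concepts K"
    from conceptD(1,2)[OF this] have "small (fst c)" "small (snd c)"
      using K small_subset unfolding small_context_def by blast+
    then show "c \<in> {A. small A} \<times> {A. small A}"
      by (simp add: mem_Times_iff)
  qed
  then show "inj_on code (concepts K)"
    by (rule inj_on_subset[OF code_inj])
qed

lemma base_context_obj: "X \<in> obj (CLjm small) \<Longrightarrow> base_context X \<in> obj (Cjm small code)"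
proof -
  assume "X \<in> obj (CLjm small)"
  then have X: "doubly_based_lattice X" "small (lcarrier X)" by simp_all
  interpret doubly_based X using X(1) by unfold_locales
  \<comment> \<open>The concepts are indexed by the elements of the lattice, so their codes form an
    image of the small carrier.\<close>
  have "code ` concepts (base_context X) = (\<lambda>x. code (below X x, above X x)) ` lcarrier X"
    by (simp add: concepts_base image_image)
  then show ?thesis
    using X(2) small_subset[OF X(2)] jbase_subset mbase_subset
    by (simp add: small_context_def small_image purified_base)
qed

lemma Bo_obj: "K \<in> obj (Cjm small code) \<Longrightarrow> ob_map (Bo_jm code) K \<in> obj (CLjm small)"
proof -
  assume "K \<in> obj (Cjm small code)"
  then have K: "small_context small code K" by simp
  interpret encoded_context K code using K by (rule encoded)
  show ?thesis
    using K doubly_based_BK by (simp add: Bo_jm_def small_context_def)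
qed

lemma functor_Co_jm: "functor_between (CLjm small) (Cjm small code) Co_jm"
proof (intro functor_between.intro category_CLjm category_Cjm functor_between_axioms.intro)
  fix X assume X: "X \<in> obj (CLjm small)"
  then show "ob_map Co_jm X \<in> obj (Cjm small code)"
    using base_context_obj by simp
  have "jbase X \<subseteq> lcarrier X" "mbase X \<subseteq> lcarrier X"
    using X by (simp_all add: doubly_based_lattice_def)
  then show "arr_map Co_jm X X (idt (CLjm small) X) = idt (Cjm small code) (ob_map Co_jm X)"
    by (simp add: Int_absorb1)
next
  fix X Y f assume "X \<in> obj (CLjm small)" "Y \<in> obj (CLjm small)" and f: "f \<in> hom (CLjm small) X Y"
  then interpret doubly_based_pair X Y
    by unfold_locales simp_all
  show "arr_map Co_jm X Y f \<in> hom (Cjm small code) (ob_map Co_jm X) (ob_map Co_jm Y)"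
    using base_morphism[of "fst f" "snd f"] f by (cases f) simp
next
  fix X Y Z f g
  assume "X \<in> obj (CLjm small)" and "f \<in> hom (CLjm small) X Y" "g \<in> hom (CLjm small) Y Z"
  then have "fst f ` jbase X \<subseteq> jbase Y" "snd f ` mbase X \<subseteq> mbase Y"
      "jbase X \<subseteq> lcarrier X" "mbase X \<subseteq> lcarrier X"
    by (auto simp: doubly_based_lattice_def CLjm_morphisms_def)
  then show "arr_map Co_jm X Z (cmp (CLjm small) X Y Z g f) =
      cmp (Cjm small code) (ob_map Co_jm X) (ob_map Co_jm Y) (ob_map Co_jm Z)
        (arr_map Co_jm Y Z g) (arr_map Co_jm X Y f)"
    by (cases f; cases g) (simp add: restrict_compose_restrict)
qed

lemma functor_Co_c: "functor_between (CL small) (Cc small code) Co_c"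
proof (intro functor_between.intro category_CL category_Cc functor_between_axioms.intro)
  interpret Co: functor_between "CLjm small" "Cjm small code" Co_jm by (rule functor_Co_jm)
  {
    fix X assume "X \<in> obj (CL small)"
    then show "ob_map Co_c X \<in> obj (Cc small code)"
      and "arr_map Co_c X X (idt (CL small) X) = idt (Cc small code) (ob_map Co_c X)"
      using Co.ob_map_obj[of X] Co.arr_map_idt[of X] by simp_all
  next
    fix X Y f assume "X \<in> obj (CL small)" "Y \<in> obj (CL small)" and f: "f \<in> hom (CL small) X Y"
    then interpret doubly_based_pair X Y
      by unfold_locales simp_all
    have "(f, f) \<in> CLjm_morphisms X Y"
      using f by (simp add: CL_morphisms_iff)
    then show "arr_map Co_c X Y f \<in> hom (Cc small code) (ob_map Co_c X) (ob_map Co_c Y)"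
      using base_morphism(1) conceptual_base_iff by simp
  next
    fix X Y Z f g
    assume "X \<in> obj (CL small)" "Y \<in> obj (CL small)" "Z \<in> obj (CL small)"
      and "f \<in> hom (CL small) X Y" "g \<in> hom (CL small) Y Z"
    then show "arr_map Co_c X Z (cmp (CL small) X Y Z g f) =
        cmp (Cc small code) (ob_map Co_c X) (ob_map Co_c Y) (ob_map Co_c Z)
          (arr_map Co_c Y Z g) (arr_map Co_c X Y f)"
      using Co.arr_map_cmp[of X Y Z "(f, f)" "(g, g)"] by (simp add: CL_morphisms_iff)
  }
qed

lemma eta_is_iso:
  assumes "K \<in> obj (Cjm small code)"
  shows "is_iso (Cc small code) K (base_context (ob_map (Bo_jm code) K)) (eta code K)"
    and "is_iso (Cjm small code) K (base_context (ob_map (Bo_jm code) K)) (eta code K)"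
proof -
  from assms have K: "purified_context K" "small_context small code K" by simp_all
  interpret encoded_context K code using K(2) by (rule encoded)
  have Bo: "ob_map (Bo_jm code) K = BK" by (simp add: Bo_jm_def)
  show "is_iso (Cc small code) K (base_context (ob_map (Bo_jm code) K)) (eta code K)"
    and "is_iso (Cjm small code) K (base_context (ob_map (Bo_jm code) K)) (eta code K)"
    unfolding eta_def Bo using bij_gamma[OF K(1)] bij_mu[OF K(1)]
    by (intro context_iso_is_iso; simp add: incid_base_BK del: BK_simps)+
qed

text \<open>This is the hypothesis \<open>F_arr\<close> for B^o. On base elements the commuting
  square says that \<open>h\<close> extends \<open>f\<close> along \<open>gamma\<close> and
  \<open>mu\<close>, and \<open>lift_eq\<close> then determines \<open>h\<close> on every concept.
  The equivalence for \<open>Cc\<close> uses it with diagonal \<open>h\<close>.\<close>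

lemma Bo_jm_arr_eq:
  assumes K: "K \<in> obj (Cjm small code)" and L: "L \<in> obj (Cjm small code)"
    and f: "f \<in> mapping_pairs K L"
    and h: "h \<in> CLjm_morphisms (ob_map (Bo_jm code) K) (ob_map (Bo_jm code) L)"
    and comm: "cmp (Cjm small code) K (base_context (ob_map (Bo_jm code) K))
        (base_context (ob_map (Bo_jm code) L))
        (arr_map Co_jm (ob_map (Bo_jm code) K) (ob_map (Bo_jm code) L) h) (eta code K) =
      cmp (Cjm small code) K L (base_context (ob_map (Bo_jm code) L)) (eta code L) f"
  shows "arr_map (Bo_jm code) K L f = h"
proof -
  interpret K: encoded_context K code using K by (intro encoded) simp
  interpret L: encoded_context L code using L by (intro encoded) simp
  have Bo: "ob_map (Bo_jm code) K = K.BK" "ob_map (Bo_jm code) L = L.BK"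
    by (simp_all add: Bo_jm_def)
  obtain \<alpha> \<beta> \<phi> \<psi> where fh: "f = (\<alpha>, \<beta>)" "h = (\<phi>, \<psi>)" by (cases f; cases h)
  have f': "\<alpha> \<in> objs K \<rightarrow> objs L" "\<beta> \<in> attrs K \<rightarrow> attrs L"
    using f by (auto simp: fh mapping_pairs_def)
  have h': "(\<phi>, \<psi>) \<in> CLjm_morphisms K.BK L.BK"
    using h by (simp add: fh Bo)
  have "compose (objs K) (restrict \<phi> (jbase K.BK)) (\<lambda>j \<in> objs K. code (gamma K j)) =
      compose (objs K) (\<lambda>j \<in> objs L. code (gamma L j)) \<alpha>"
    and "compose (attrs K) (restrict \<psi> (mbase K.BK)) (\<lambda>m \<in> attrs K. code (mu K m)) =
      compose (attrs K) (\<lambda>m \<in> attrs L. code (mu L m)) \<beta>"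
    using comm by (simp_all add: fh Bo eta_def)
  \<comment> \<open>Evaluating the square pointwise turns it into the intertwining conditions that
    \<open>lift_eq\<close> expects.\<close>
  from fun_cong[OF this(1)] fun_cong[OF this(2)]
  have "\<And>j. j \<in> objs K \<Longrightarrow> \<phi> (code (gamma K j)) = code (gamma L (\<alpha> j))"
    and "\<And>m. m \<in> attrs K \<Longrightarrow> \<psi> (code (mu K m)) = code (mu L (\<beta> m))"
    using f' by (simp_all add: compose_def Pi_iff restrict_def if_split)
  note lift = lift_eq[OF K.encoded_context_axioms L.encoded_context_axioms f[unfolded fh] h' this]
  have carrier: "lcarrier (augmented_lattice K) = concepts K"
    by (simp add: augmented_lattice_def concept_lattice_def)
  have ext: "\<phi> \<in> extensional (code ` concepts K)" "\<psi> \<in> extensional (code ` concepts K)"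
    using h' by (simp_all add: CLjm_morphisms_def PiE_def)
  have "rename_map code (augmented_lattice K) (alpha_lift L \<alpha>) = \<phi>"
    "rename_map code (augmented_lattice K) (beta_lift L \<beta>) = \<psi>"
    by (rule rename_map_eq; simp add: carrier ext lift K.inj_code)+
  then show ?thesis
    by (simp add: Bo_jm_def fh)
qed

lemma equivalence_jm: "category_equivalence (Cjm small code) (CLjm small) (Bo_jm code) Co_jm"
proof (rule category_equivalenceI[where \<eta> = "eta code"])
  show "functor_between (CLjm small) (Cjm small code) Co_jm"
    by (rule functor_Co_jm)
next
  fix X Y f g
  assume "X \<in> obj (CLjm small)" "Y \<in> obj (CLjm small)" and fg: "f \<in> hom (CLjm small) X Y"
    "g \<in> hom (CLjm small) X Y" "arr_map Co_jm X Y f = arr_map Co_jm X Y g"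
  then interpret doubly_based_pair X Y
    by unfold_locales simp_all
  obtain \<phi> \<psi> \<phi>' \<psi>' where "f = (\<phi>, \<psi>)" "g = (\<phi>', \<psi>')" by (cases f; cases g)
  with fg show "f = g"
    using base_morphism_faithful[of \<phi> \<psi> \<phi>' \<psi>'] by simp
next
  fix X Y f
  assume "X \<in> obj (CLjm small)" "Y \<in> obj (CLjm small)"
    and f: "f \<in> hom (Cjm small code) (ob_map Co_jm X) (ob_map Co_jm Y)"
  then interpret doubly_based_pair X Y
    by unfold_locales simp_all
  obtain \<alpha> \<beta> where \<alpha>\<beta>: "f = (\<alpha>, \<beta>)" by (cases f)
  obtain \<phi> \<psi> where "(\<phi>, \<psi>) \<in> CLjm_morphisms X Y" "restrict \<phi> (jbase X) = \<alpha>"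
      "restrict \<psi> (mbase X) = \<beta>"
    by (rule base_morphism_full[of \<alpha> \<beta>]) (use f in \<open>simp_all add: \<alpha>\<beta>\<close>)
  then show "\<exists>h \<in> hom (CLjm small) X Y. arr_map Co_jm X Y h = f"
    by (intro bexI[of _ "(\<phi>, \<psi>)"]) (simp_all add: \<alpha>\<beta>)
next
  fix K L f h
  assume "K \<in> obj (Cjm small code)" "L \<in> obj (Cjm small code)" "f \<in> hom (Cjm small code) K L"
    "h \<in> hom (CLjm small) (ob_map (Bo_jm code) K) (ob_map (Bo_jm code) L)"
    and "cmp (Cjm small code) K (ob_map Co_jm (ob_map (Bo_jm code) K))
        (ob_map Co_jm (ob_map (Bo_jm code) L))
        (arr_map Co_jm (ob_map (Bo_jm code) K) (ob_map (Bo_jm code) L) h) (eta code K) =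
      cmp (Cjm small code) K L (ob_map Co_jm (ob_map (Bo_jm code) L)) (eta code L) f"
  then show "arr_map (Bo_jm code) K L f = h"
    by (intro Bo_jm_arr_eq) simp_all
qed (use Bo_obj eta_is_iso(2) in simp_all)

lemma equivalence_c: "category_equivalence (Cc small code) (CL small) (Bo_c code) Co_c"
proof (rule category_equivalenceI[where \<eta> = "eta code"])
  show "functor_between (CL small) (Cc small code) Co_c"
    by (rule functor_Co_c)
next
  fix X Y f g
  assume "X \<in> obj (CL small)" "Y \<in> obj (CL small)" and fg: "f \<in> hom (CL small) X Y"
    "g \<in> hom (CL small) X Y" "arr_map Co_c X Y f = arr_map Co_c X Y g"
  then interpret doubly_based_pair X Y
    by unfold_locales simp_all
  show "f = g"
    using fg base_morphism_faithful[of f f g g] by (simp add: CL_morphisms_iff)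
next
  fix X Y f
  assume "X \<in> obj (CL small)" "Y \<in> obj (CL small)"
    and f: "f \<in> hom (Cc small code) (ob_map Co_c X) (ob_map Co_c Y)"
  then interpret doubly_based_pair X Y
    by unfold_locales simp_all
  obtain \<alpha> \<beta> where \<alpha>\<beta>: "f = (\<alpha>, \<beta>)" by (cases f)
  obtain \<phi> \<psi> where \<phi>\<psi>: "(\<phi>, \<psi>) \<in> CLjm_morphisms X Y" "restrict \<phi> (jbase X) = \<alpha>"
      "restrict \<psi> (mbase X) = \<beta>"
    by (rule base_morphism_full[of \<alpha> \<beta>])
      (use f in \<open>simp_all add: \<alpha>\<beta> conceptual_separately_continuous\<close>)
  \<comment> \<open>Fullness is inherited from the larger categories: conceptuality of
    \<open>f\<close> makes its two extensions coincide, and the common map is a complete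
    homomorphism.\<close>
  have "\<phi> = \<psi>"
    using f conceptual_base_iff[OF \<phi>\<psi>(1)] by (simp add: \<alpha>\<beta> \<phi>\<psi>(2,3))
  with \<phi>\<psi> show "\<exists>h \<in> hom (CL small) X Y. arr_map Co_c X Y h = f"
    by (intro bexI[of _ \<phi>]) (simp_all add: \<alpha>\<beta> CL_morphisms_iff)
next
  fix K L f h
  assume KL: "K \<in> obj (Cc small code)" "L \<in> obj (Cc small code)" and f: "f \<in> hom (Cc small code) K L"
    and h: "h \<in> hom (CL small) (ob_map (Bo_c code) K) (ob_map (Bo_c code) L)"
    and comm: "cmp (Cc small code) K (ob_map Co_c (ob_map (Bo_c code) K))
        (ob_map Co_c (ob_map (Bo_c code) L))
        (arr_map Co_c (ob_map (Bo_c code) K) (ob_map (Bo_c code) L) h) (eta code K) =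
      cmp (Cc small code) K L (ob_map Co_c (ob_map (Bo_c code) L)) (eta code L) f"
  have Bo: "ob_map (Bo_c code) = ob_map (Bo_jm code)"
    by (simp add: Bo_c_def)
  \<comment> \<open>The value of the pair functor is diagonal here, so the first component taken by
    \<open>Bo_c\<close> is all of it.\<close>
  have "arr_map (Bo_jm code) K L f = (h, h)"
    using KL f h comm by (intro Bo_jm_arr_eq) (simp_all add: Bo CL_morphisms_iff)
  then show "arr_map (Bo_c code) K L f = h"
    by (simp add: Bo_c_def)
qed (use Bo_obj eta_is_iso(1) in \<open>simp_all add: Bo_c_def\<close>)

end

theorem theorem7p1:
  fixes small :: "'u set \<Rightarrow> bool" and code :: "'u set \<times> 'u set \<Rightarrow> 'u"
  assumes "universe small code"
  shows "category_equivalence (Cjm small code) (CLjm small) (Bo_jm code) Co_jm \<and>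
         category_equivalence (Cc small code) (CL small) (Bo_c code) Co_c"
  using universe.equivalence_jm[OF assms] universe.equivalence_c[OF assms] by blast

end
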